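(* Let $p$ be a prime, $1<r<\infty$ and $\alpha>0$, and let the $p$-adic Hilbert operator be defined by $$H^pf(x)=\int_{\mathbb{Q}_p^*}\frac{f(y)}{|x|_p+|y|_p}\,dy,\qquad x\in\mathbb{Q}_p^*.$$ If $0<1/r+\alpha<1$, then there is a constant $C>0$ such that for any $f\in\mathfrak{B}_{r,\alpha}(\mathbb{Q}_p^* )$, $$\|H^pf\|_{\mathfrak{B}_{r,\alpha}(\mathbb{Q}_p^* )}\le C\,\|f\|_{\mathfrak{B}_{r,\alpha}(\mathbb{Q}_p^* )}.$$
   Context: $\mathbb{Q}_p$ is the field of $p$-adic numbers with absolute value $|\cdot|_p$, and $\mathbb{Q}_p^*=\mathbb{Q}_p\setminus\{0\}$. $dx$ is the Haar measure on the additive group $\mathbb{Q}_p$ normalized so that $\{|x|_p\le1\}$ has measure $1$, and $|E|$ denotes the Haar measure of $E$. For $n\in\mathbb{Z}$, $B^n=\{x\in\mathbb{Q}_p:|x|_p\le p^n\}$, so $|B^n|=p^n$. A function $a:\mathbb{Q}_p^*\to\mathbb{C}$ is a central $(r,\alpha)$-block if there exists $n\in\mathbb{Z}$ such that $\operatorname{supp}a\subset B^n$ and $\|a\|_{L^r}\le|B^n|^{-\alpha}$. The block space $\mathfrak{B}_{r,\alpha}(\mathbb{Q}_p^* )$ is the set of all $f\in L^r_{\mathrm{loc}}(\mathbb{Q}_p^* )$ that can be written as $f=\sum_{k=1}^\infty\lambda_ka_k$ (almost everywhere) with scalars $\lambda_k$ satisfying $\sum_k|\lambda_k|<\infty$ and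 each $a_k$ a central $(r,\alpha)$-block; its norm is $\|f\|_{\mathfrak{B}_{r,\alpha}(\mathbb{Q}_p^* )}=\inf\sum_{k=1}^\infty|\lambda_k|$, the infimum being over all such decompositions of $f$. *)

theory Defs
  imports
    "HOL-Analysis.Analysis"
    "HOL-Computational_Algebra.Primes"
begin

section \<open>The \<open>p\<close>-adic absolute value on the rationals\<close>

text \<open>For \<open>q = a / b\<close> this is \<open>p\<close> to the power \<open>v(b) - v(a)\<close>, where \<open>v\<close> is the multiplicity of \<open>p\<close>
  (see \<open>N_Fract\<close> below for arbitrary fractions).\<close>

definition padic_abs_rat :: "nat \<Rightarrow> rat \<Rightarrow> real" where
  "padic_abs_rat p q =
     (if q = 0 then 0
      else real p powi (int (multiplicity (int p) (snd (quotient_of q)))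
                        - int (multiplicity (int p) (fst (quotient_of q)))))"

lemma padic_abs_rat_0 [simp]: "padic_abs_rat p 0 = 0"
  by (simp add: padic_abs_rat_def)

lemma padic_abs_rat_1 [simp]: "padic_abs_rat p 1 = 1"
  by (simp add: padic_abs_rat_def)

locale padic_rat =
  fixes p :: nat
  assumes prime_p: "prime p"
begin

abbreviation N :: "rat \<Rightarrow> real" where "N \<equiv> padic_abs_rat p"

lemma p_pos: "real p > 0"
  using prime_p prime_gt_0_nat by simp

lemma p_gt_1: "real p > 1"
  using prime_p prime_gt_1_nat by simp

lemma prime_int_p: "prime (int p)"
  using prime_p by simp

lemma mult_mult:
  assumes "a \<noteq> 0" "b \<noteq> 0"
  shows "multiplicity (int p) (a * b) = multiplicity (int p) a + multiplicity (int p) b"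
  using assms prime_int_p by (intro prime_elem_multiplicity_mult_distrib) auto

lemma N_Fract:
  assumes "a \<noteq> 0" "b \<noteq> 0"
  shows "N (of_int a / of_int b)
           = real p powi (int (multiplicity (int p) b) - int (multiplicity (int p) a))"
proof -
  obtain c d where q: "quotient_of (of_int a / of_int b) = (c, d)"
    by (cases "quotient_of (of_int a / of_int b)")
  have d: "d > 0" using quotient_of_denom_pos[OF q] .
  have e: "of_int a / of_int b = (of_int c / of_int d :: rat)"
    using quotient_of_div[OF q] .
  with assms d have "of_int (a * d) = (of_int (c * b) :: rat)"
    by (simp add: field_simps)
  then have ad: "a * d = c * b" by (simp only: of_int_eq_iff)
  with assms d have c: "c \<noteq> 0" by auto
  have "multiplicity (int p) (a * d) = multiplicity (int p) (c * b)" using ad by simp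
  then have "multiplicity (int p) a + multiplicity (int p) d
       = multiplicity (int p) c + multiplicity (int p) b"
    using mult_mult[of a d] mult_mult[of c b] assms c d by simp
  then have "int (multiplicity (int p) d) - int (multiplicity (int p) c)
       = int (multiplicity (int p) b) - int (multiplicity (int p) a)" by linarith
  then show ?thesis using assms q by (simp add: padic_abs_rat_def)
qed

lemma rat_cases:
  fixes q :: rat
  obtains a b where "q = of_int a / of_int b" "b \<noteq> 0"
proof -
  obtain a b where q: "quotient_of q = (a, b)" by (cases "quotient_of q")
  show ?thesis using that[OF quotient_of_div[OF q]] quotient_of_denom_pos[OF q] by simp
qed

lemma N_nonneg [simp]: "N q \<ge> 0"
  using p_pos by (simp add: padic_abs_rat_def)

lemma N_pos: "q \<noteq> 0 \<Longrightarrow> N q > 0"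
  using p_pos by (simp add: padic_abs_rat_def)

lemma N_eq_0 [simp]: "N q = 0 \<longleftrightarrow> q = 0"
  by (metis N_pos less_irrefl padic_abs_rat_0)

lemma N_mult: "N (x * y) = N x * N y"
proof (cases "x = 0 \<or> y = 0")
  case False
  obtain a b where x: "x = of_int a / of_int b" "b \<noteq> 0" by (rule rat_cases)
  obtain c d where y: "y = of_int c / of_int d" "d \<noteq> 0" by (rule rat_cases)
  from False x y have nz: "a \<noteq> 0" "c \<noteq> 0" by auto
  have "x * y = of_int (a * c) / of_int (b * d)" using x y by simp
  then have "N (x * y) = real p powi (int (multiplicity (int p) (b * d))
      - int (multiplicity (int p) (a * c)))"
    using N_Fract[of "a * c" "b * d"] nz x y by simp
  also have "\<dots> = real p powi ((int (multiplicity (int p) b) - int (multiplicity (int p) a))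
      + (int (multiplicity (int p) d) - int (multiplicity (int p) c)))"
    using mult_mult[of b d] mult_mult[of a c] nz x y by (simp add: algebra_simps)
  also have "\<dots> = N x * N y"
    using N_Fract nz x y p_pos by (simp add: power_int_add)
  finally show ?thesis .
qed auto

lemma N_minus [simp]: "N (- x) = N x"
proof -
  have "N (-1) * N (-1) = 1" using N_mult[of "-1" "-1"] by simp
  then have "N (-1) = 1" using N_nonneg[of "-1"]
    by (simp add: square_eq_1_iff)
  then show ?thesis using N_mult[of "-1" x] by simp
qed

lemma N_inverse: "N (inverse x) = inverse (N x)"
proof (cases "x = 0")
  case False
  then have "N x * N (inverse x) = 1" by (simp flip: N_mult)
  then show ?thesis using inverse_unique by metis
qed auto

lemma N_add: "N (x + y) \<le> max (N x) (N y)"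
proof (cases "x = 0 \<or> y = 0 \<or> x + y = 0")
  case True
  then show ?thesis by (auto simp: le_max_iff_disj)
next
  case False
  obtain a b where x: "x = of_int a / of_int b" "b \<noteq> 0" by (rule rat_cases)
  obtain c d where y: "y = of_int c / of_int d" "d \<noteq> 0" by (rule rat_cases)
  define u v w where "u = a * d" and "v = c * b" and "w = b * d"
  have w: "w \<noteq> 0" using x y by (simp add: w_def)
  have xu: "x = of_int u / of_int w" and yv: "y = of_int v / of_int w"
    using x y by (auto simp: u_def v_def w_def)
  have s: "x + y = of_int (u + v) / of_int w" by (simp add: xu yv add_divide_distrib)
  from False have nz: "u \<noteq> 0" "v \<noteq> 0"
    unfolding xu yv by auto
  have "u + v \<noteq> 0"
  proof
    assume "u + v = 0"
    then have "x + y = 0" unfolding s by (simp del: of_int_add)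
    with False show False by simp
  qed
  note nz = nz this
  define m where "m = min (multiplicity (int p) u) (multiplicity (int p) v)"
  have "int p ^ m dvd u" "int p ^ m dvd v"
    by (auto simp: m_def intro: multiplicity_dvd')
  then have "int p ^ m dvd u + v" by simp
  moreover have "\<not> is_unit (int p)" using prime_int_p by (meson not_prime_unit)
  ultimately have m: "m \<le> multiplicity (int p) (u + v)"
    using nz by (intro multiplicity_geI) auto
  have "N (x + y) = real p powi (int (multiplicity (int p) w)
      - int (multiplicity (int p) (u + v)))"
    unfolding s by (rule N_Fract) (use nz w in auto)
  also have "\<dots> \<le> real p powi (int (multiplicity (int p) w) - int m)"
    using m p_gt_1 by (intro power_int_increasing) auto
  also have "\<dots> = max (N x) (N y) \<or> \<dots> = N x \<or> \<dots> = N y"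
    unfolding xu yv using N_Fract[OF nz(1) w] N_Fract[OF nz(2) w] by (auto simp: m_def min_def)
  then have "real p powi (int (multiplicity (int p) w) - int m) \<le> max (N x) (N y)" by auto
  finally show ?thesis .
qed

lemma N_diff: "N (x - y) \<le> max (N x) (N y)"
  using N_add[of x "- y"] by simp

lemma N_diff_commute: "N (x - y) = N (y - x)"
  using N_minus[of "x - y"] by simp

lemma N_triangle: "N (x + y) \<le> N x + N y"
  using N_add[of x y] N_nonneg[of x] N_nonneg[of y] by linarith

lemma N_abs_diff: "\<bar>N x - N y\<bar> \<le> N (x - y)"
  using N_triangle[of "x - y" y] N_triangle[of "y - x" x] N_diff_commute[of x y] by simp

definition cauchy :: "(nat \<Rightarrow> rat) \<Rightarrow> bool" where
  "cauchy X \<longleftrightarrow> (\<forall>e>0. \<exists>k. \<forall>m\<ge>k. \<forall>n\<ge>k. N (X m - X n) < e)"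

definition vanishes :: "(nat \<Rightarrow> rat) \<Rightarrow> bool" where
  "vanishes X \<longleftrightarrow> (\<lambda>n. N (X n)) \<longlonglongrightarrow> 0"

definition padic_rel :: "(nat \<Rightarrow> rat) \<Rightarrow> (nat \<Rightarrow> rat) \<Rightarrow> bool" where
  "padic_rel X Y \<longleftrightarrow> cauchy X \<and> cauchy Y \<and> vanishes (\<lambda>n. X n - Y n)"

lemma vanishes_dom:
  assumes "vanishes X" "vanishes Y" "\<And>n. N (Z n) \<le> N (X n) + N (Y n)"
  shows "vanishes Z"
  unfolding vanishes_def
proof (rule tendsto_sandwich[OF _ _ tendsto_const])
  show "(\<lambda>n. N (X n) + N (Y n)) \<longlonglongrightarrow> 0"
    using tendsto_add[OF assms(1,2)[unfolded vanishes_def]] by simp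
qed (use assms in auto)

lemma vanishes_0 [simp]: "vanishes (\<lambda>n. 0)" by (simp add: vanishes_def)

lemma vanishes_const [simp]: "vanishes (\<lambda>n. c) \<longleftrightarrow> c = 0"
  by (simp add: vanishes_def LIMSEQ_const_iff)

lemma vanishes_add: "vanishes X \<Longrightarrow> vanishes Y \<Longrightarrow> vanishes (\<lambda>n. X n + Y n)"
  by (rule vanishes_dom[of X Y]) (auto intro: N_triangle)

lemma vanishes_minus: "vanishes X \<Longrightarrow> vanishes (\<lambda>n. - X n)"
  by (simp add: vanishes_def)

lemma vanishes_diff: "vanishes X \<Longrightarrow> vanishes Y \<Longrightarrow> vanishes (\<lambda>n. X n - Y n)"
  using vanishes_add[of X "\<lambda>n. - Y n"] vanishes_minus[of Y] by simp

lemma cauchy_const [simp]: "cauchy (\<lambda>n. c)" by (simp add: cauchy_def)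

lemma cauchyI_dom:
  assumes "cauchy X" "cauchy Y" "\<And>m n. N (Z m - Z n) \<le> max (N (X m - X n)) (N (Y m - Y n))"
  shows "cauchy Z"
  unfolding cauchy_def
proof (intro allI impI)
  fix e :: real assume "e > 0"
  obtain k where k: "\<forall>m\<ge>k. \<forall>n\<ge>k. N (X m - X n) < e"
    using assms(1) \<open>e > 0\<close> unfolding cauchy_def by blast
  obtain l where l: "\<forall>m\<ge>l. \<forall>n\<ge>l. N (Y m - Y n) < e"
    using assms(2) \<open>e > 0\<close> unfolding cauchy_def by blast
  have "N (Z m - Z n) < e" if "m \<ge> max k l" "n \<ge> max k l" for m n
  proof -
    have "N (X m - X n) < e" "N (Y m - Y n) < e" using k l that by auto
    then show ?thesis using assms(3)[of m n] by linarith
  qed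
  then show "\<exists>k. \<forall>m\<ge>k. \<forall>n\<ge>k. N (Z m - Z n) < e" by blast
qed

lemma cauchy_add [simp]: "cauchy X \<Longrightarrow> cauchy Y \<Longrightarrow> cauchy (\<lambda>n. X n + Y n)"
  by (rule cauchyI_dom[of X Y]) (simp_all only: add_diff_add N_add)

lemma cauchy_minus [simp]: "cauchy X \<Longrightarrow> cauchy (\<lambda>n. - X n)"
proof (rule cauchyI_dom)
  fix m n show "N (- X m - - X n) \<le> max (N (X m - X n)) (N (X m - X n))"
    using N_diff_commute[of "X m" "X n"] by simp
qed

lemma cauchy_diff [simp]: "cauchy X \<Longrightarrow> cauchy Y \<Longrightarrow> cauchy (\<lambda>n. X n - Y n)"
  using cauchy_add[of X "\<lambda>n. - Y n"] by simp

lemma cauchy_convergent: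
  assumes "cauchy X"
  shows "convergent (\<lambda>n. N (X n))"
proof -
  have "Cauchy (\<lambda>n. N (X n))"
  proof (rule CauchyI)
    fix e :: real assume "e > 0"
    then obtain k where k: "\<forall>m\<ge>k. \<forall>n\<ge>k. N (X m - X n) < e"
      using assms unfolding cauchy_def by meson
    have "norm (N (X m) - N (X n)) < e" if "m \<ge> k" "n \<ge> k" for m n
      using k[rule_format, OF that] N_abs_diff[of "X m" "X n"] by simp
    then show "\<exists>M. \<forall>m\<ge>M. \<forall>n\<ge>M. norm (N (X m) - N (X n)) < e" by blast
  qed
  then show ?thesis by (simp add: Cauchy_convergent_iff)
qed

lemma cauchy_bounded:
  assumes "cauchy X"
  obtains B where "B > 0" "\<And>n. N (X n) \<le> B"
proof -
  obtain B where "B > 0" "\<forall>n. norm (N (X n)) \<le> B"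
    using convergent_imp_Bseq[OF cauchy_convergent[OF assms]] by (rule BseqE) blast
  then show ?thesis by (intro that[of B]) auto
qed

lemma vanishes_mult_bounded:
  assumes "cauchy X" "vanishes Y"
  shows "vanishes (\<lambda>n. X n * Y n)"
proof -
  obtain B where B: "B > 0" "\<And>n. N (X n) \<le> B" by (rule cauchy_bounded[OF assms(1)]) blast
  have lim: "(\<lambda>n. B * N (Y n)) \<longlonglongrightarrow> 0"
    using assms(2) unfolding vanishes_def by (rule tendsto_mult_right_zero)
  show ?thesis unfolding vanishes_def
    by (rule tendsto_sandwich[OF _ _ tendsto_const lim])
       (use B in \<open>auto simp: N_mult intro!: mult_right_mono always_eventually\<close>)
qed

lemma cauchy_mult [simp]:
  assumes "cauchy X" "cauchy Y"
  shows "cauchy (\<lambda>n. X n * Y n)"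
  unfolding cauchy_def
proof (intro allI impI)
  fix e :: real assume e: "e > 0"
  obtain A where A: "A > 0" "\<And>n. N (X n) \<le> A" by (rule cauchy_bounded[OF assms(1)]) blast
  obtain B where B: "B > 0" "\<And>n. N (Y n) \<le> B" by (rule cauchy_bounded[OF assms(2)]) blast
  have "e / B > 0" "e / A > 0" using e A B by auto
  then obtain k l where k: "\<forall>m\<ge>k. \<forall>n\<ge>k. N (X m - X n) < e / B"
      and l: "\<forall>m\<ge>l. \<forall>n\<ge>l. N (Y m - Y n) < e / A"
    using assms unfolding cauchy_def by meson
  have "N (X m * Y m - X n * Y n) < e" if "m \<ge> max k l" "n \<ge> max k l" for m n
  proof -
    have "X m * Y m - X n * Y n = X m * (Y m - Y n) + (X m - X n) * Y n"
      by (simp add: algebra_simps)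
    then have "N (X m * Y m - X n * Y n)
        \<le> max (N (X m) * N (Y m - Y n)) (N (X m - X n) * N (Y n))"
      using N_add[of "X m * (Y m - Y n)" "(X m - X n) * Y n"] by (simp add: N_mult)
    moreover have "N (X m) * N (Y m - Y n) < e"
    proof -
      have "N (X m) * N (Y m - Y n) \<le> A * N (Y m - Y n)" using A by (intro mult_right_mono) auto
      also have "\<dots> < A * (e / A)" using l that A by (intro mult_strict_left_mono) auto
      finally show ?thesis using A by simp
    qed
    moreover have "N (X m - X n) * N (Y n) < e"
    proof -
      have "N (X m - X n) * N (Y n) \<le> N (X m - X n) * B" using B by (intro mult_left_mono) auto
      also have "\<dots> < (e / B) * B" using k that B by (intro mult_strict_right_mono) auto
      finally show ?thesis using B by simp
    qed
    ultimately show ?thesis by simp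
  qed
  then show "\<exists>k. \<forall>m\<ge>k. \<forall>n\<ge>k. N (X m * Y m - X n * Y n) < e" by blast
qed

lemma cauchy_not_vanishes:
  assumes "cauchy X" "\<not> vanishes X"
  obtains b k where "b > 0" "\<And>n. n \<ge> k \<Longrightarrow> N (X n) > b"
proof -
  obtain L where L: "(\<lambda>n. N (X n)) \<longlonglongrightarrow> L"
    using cauchy_convergent[OF assms(1)] by (auto simp: convergent_def)
  then have "L \<ge> 0" by (rule LIMSEQ_le_const) auto
  moreover have "L \<noteq> 0" using L assms(2) by (auto simp: vanishes_def)
  ultimately have "L / 2 > 0" "L / 2 < L" by auto
  moreover from this obtain k where "\<forall>n\<ge>k. L / 2 < N (X n)"
    using order_tendstoD(1)[OF L, of "L / 2"] by (auto simp: eventually_sequentially)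
  ultimately show ?thesis using that[of "L / 2" k] by blast
qed

lemma N_inverse_diff:
  assumes "N x > b" "N y > c" "b > 0" "c > 0"
  shows "N (inverse x - inverse y) \<le> N (x - y) / (b * c)"
proof -
  have nz: "x \<noteq> 0" "y \<noteq> 0" using assms by auto
  then have "inverse x - inverse y = - (inverse x * (x - y) * inverse y)"
    by (simp add: field_simps)
  then have "N (inverse x - inverse y) = N (x - y) / (N x * N y)"
    by (simp add: N_mult N_inverse divide_inverse)
  also have "\<dots> \<le> N (x - y) / (b * c)"
    using assms by (intro divide_left_mono mult_mono mult_pos_pos) auto
  finally show ?thesis .
qed

lemma cauchy_inverse [simp]:
  assumes "cauchy X" "\<not> vanishes X"
  shows "cauchy (\<lambda>n. inverse (X n))"
  unfolding cauchy_def
proof (intro allI impI)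
  fix e :: real assume e: "e > 0"
  obtain b k where b: "b > 0" "\<And>n. n \<ge> k \<Longrightarrow> N (X n) > b"
    by (rule cauchy_not_vanishes[OF assms]) blast
  have "e * (b * b) > 0" using e b by simp
  then obtain l where l: "\<forall>m\<ge>l. \<forall>n\<ge>l. N (X m - X n) < e * (b * b)"
    using assms(1) unfolding cauchy_def by meson
  have "N (inverse (X m) - inverse (X n)) < e" if "m \<ge> max k l" "n \<ge> max k l" for m n
  proof -
    have "N (inverse (X m) - inverse (X n)) \<le> N (X m - X n) / (b * b)"
      using b that by (intro N_inverse_diff) auto
    also have "\<dots> < e" using l that b by (simp add: divide_less_eq)
    finally show ?thesis .
  qed
  then show "\<exists>k. \<forall>m\<ge>k. \<forall>n\<ge>k. N (inverse (X m) - inverse (X n)) < e" by blast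
qed

lemma vanishes_diff_inverse:
  assumes X: "cauchy X" "\<not> vanishes X" and Y: "cauchy Y" "\<not> vanishes Y"
    and XY: "vanishes (\<lambda>n. X n - Y n)"
  shows "vanishes (\<lambda>n. inverse (X n) - inverse (Y n))"
proof -
  obtain b k where b: "b > 0" "\<And>n. n \<ge> k \<Longrightarrow> N (X n) > b"
    by (rule cauchy_not_vanishes[OF X]) blast
  obtain c l where c: "c > 0" "\<And>n. n \<ge> l \<Longrightarrow> N (Y n) > c"
    by (rule cauchy_not_vanishes[OF Y]) blast
  have lim: "(\<lambda>n. N (X n - Y n) / (b * c)) \<longlonglongrightarrow> 0"
    using XY unfolding vanishes_def by (rule tendsto_divide_zero)
  have ev: "eventually (\<lambda>n. N (inverse (X n) - inverse (Y n)) \<le> N (X n - Y n) / (b * c))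
      sequentially"
    using eventually_ge_at_top[of "max k l"]
    by eventually_elim (use b c in \<open>auto intro!: N_inverse_diff\<close>)
  show ?thesis unfolding vanishes_def
    by (rule tendsto_sandwich[OF always_eventually ev tendsto_const lim]) simp
qed

lemma vanishes_diff_commute: "vanishes (\<lambda>n. X n - Y n) \<Longrightarrow> vanishes (\<lambda>n. Y n - X n)"
  using vanishes_minus[of "\<lambda>n. X n - Y n"] by simp

lemma part_equivp_padic_rel: "part_equivp padic_rel"
proof (rule part_equivpI)
  have "padic_rel (\<lambda>n. 0) (\<lambda>n. 0)" by (simp add: padic_rel_def)
  then show "\<exists>X. padic_rel X X" by blast
  show "symp padic_rel"
  proof (rule sympI)
    fix X Y assume "padic_rel X Y"
    then show "padic_rel Y X"
      unfolding padic_rel_def using vanishes_diff_commute[of X Y] by simp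
  qed
  show "transp padic_rel"
  proof (rule transpI)
    fix X Y Z assume "padic_rel X Y" "padic_rel Y Z"
    then show "padic_rel X Z"
      using vanishes_add[of "\<lambda>n. X n - Y n" "\<lambda>n. Y n - Z n"] by (simp add: padic_rel_def)
  qed
qed

lemma padic_rel_vanishes: "padic_rel X Y \<Longrightarrow> vanishes X \<longleftrightarrow> vanishes Y"
proof -
  assume "padic_rel X Y"
  then have v: "vanishes (\<lambda>n. X n - Y n)" by (simp add: padic_rel_def)
  show ?thesis
  proof
    assume "vanishes X"
    from vanishes_diff[OF this v] show "vanishes Y" by simp
  next
    assume "vanishes Y"
    from vanishes_add[OF v this] show "vanishes X" by simp
  qed
qed

lemma padic_rel_lim: "padic_rel X Y \<Longrightarrow> lim (\<lambda>n. N (X n)) = lim (\<lambda>n. N (Y n))"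
proof -
  assume r: "padic_rel X Y"
  obtain L where L: "(\<lambda>n. N (X n)) \<longlonglongrightarrow> L"
    using cauchy_convergent[of X] r unfolding convergent_def padic_rel_def by blast
  have v: "(\<lambda>n. N (X n - Y n)) \<longlonglongrightarrow> 0" using r by (simp add: padic_rel_def vanishes_def)
  have "(\<lambda>n. N (X n) - N (Y n)) \<longlonglongrightarrow> 0"
    by (rule Lim_null_comparison[OF _ v]) (simp add: N_abs_diff)
  from tendsto_diff[OF L this] have M: "(\<lambda>n. N (Y n)) \<longlonglongrightarrow> L" by simp
  show ?thesis using limI[OF L] limI[OF M] by simp
qed

end


section \<open>The field of \<open>p\<close>-adic numbers\<close>

text \<open>The prime is carried by the type: \<open>'p padic\<close> is the field of \<open>p\<close>-adic numbers for
  \<open>p = CARD('p)\<close>, built as Cauchy sequences of rationals modulo null sequences.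
  The lemmas \<open>padic_abs_of_rat\<close>, \<open>padic_rat_dense\<close> and the \<open>complete_space\<close> instance below
  identify it as the completion of the rationals for \<open>padic_abs_rat\<close>.\<close>

class prime_card =
  assumes prime_card: "prime CARD('a)"

lemma padic_rat_CARD: "padic_rat CARD('p::prime_card)"
  by standard (rule prime_card)

interpretation P: padic_rat "CARD('p::prime_card)"
  by (rule padic_rat_CARD)

typedef ('p::prime_card) padic =
    "{C. \<exists>X. padic_rat.cauchy CARD('p) X \<and> C = {Y. padic_rat.padic_rel CARD('p) X Y}}"
  using padic_rat.cauchy_const[OF padic_rat_CARD] by blast

definition padic_of_seq :: "(nat \<Rightarrow> rat) \<Rightarrow> 'p::prime_card padic" where
  "padic_of_seq X = Abs_padic {Y. padic_rat.padic_rel CARD('p) X Y}"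

definition padic_rep :: "'p::prime_card padic \<Rightarrow> nat \<Rightarrow> rat" where
  "padic_rep x = (SOME X. X \<in> Rep_padic x)"

lemma padic_rep:
  fixes x :: "'p::prime_card padic"
  shows "padic_rat.cauchy CARD('p) (padic_rep x)" "padic_of_seq (padic_rep x) = x"
proof -
  obtain X where X: "P.cauchy TYPE('p) X" "Rep_padic x = {Y. P.padic_rel TYPE('p) X Y}"
    using Rep_padic[of x] by auto
  then have "X \<in> Rep_padic x" by (simp add: P.padic_rel_def)
  then have "padic_rep x \<in> Rep_padic x" 
    unfolding padic_rep_def using someI[of "\<lambda>X. X \<in> Rep_padic x" X] by blast
  then have r: "P.padic_rel TYPE('p) X (padic_rep x)" using X by simp
  then show "P.cauchy TYPE('p) (padic_rep x)" by (simp add: P.padic_rel_def)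
  have "{Y. P.padic_rel TYPE('p) (padic_rep x) Y} = {Y. P.padic_rel TYPE('p) X Y}"
    using r part_equivp_symp[OF P.part_equivp_padic_rel] part_equivp_transp[OF P.part_equivp_padic_rel]
    by (intro Collect_cong) blast
  then show "padic_of_seq (padic_rep x) = x"
    unfolding padic_of_seq_def by (simp add: X(2)[symmetric] Rep_padic_inverse)
qed

lemma padic_of_seq_eq_iff:
  assumes "padic_rat.cauchy CARD('p::prime_card) X" "padic_rat.cauchy CARD('p) Y"
  shows "padic_of_seq X = (padic_of_seq Y :: 'p padic)
     \<longleftrightarrow> padic_rat.vanishes CARD('p) (\<lambda>n. X n - Y n)"
proof -
  have "padic_of_seq X = (padic_of_seq Y :: 'p padic) \<longleftrightarrow>
      {Z. P.padic_rel TYPE('p) X Z} = {Z. P.padic_rel TYPE('p) Y Z}"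
    unfolding padic_of_seq_def by (rule Abs_padic_inject) (use assms in blast)+
  also have "\<dots> \<longleftrightarrow> P.padic_rel TYPE('p) X Y"
  proof
    assume e: "{Z. P.padic_rel TYPE('p) X Z} = {Z. P.padic_rel TYPE('p) Y Z}"
    have "P.padic_rel TYPE('p) Y Y" using assms by (simp add: P.padic_rel_def)
    with e show "P.padic_rel TYPE('p) X Y" by blast
  next
    assume r: "P.padic_rel TYPE('p) X Y"
    then show "{Z. P.padic_rel TYPE('p) X Z} = {Z. P.padic_rel TYPE('p) Y Z}"
      using part_equivp_symp[OF P.part_equivp_padic_rel] part_equivp_transp[OF P.part_equivp_padic_rel]
      by (intro Collect_cong) blast
  qed
  finally show ?thesis using assms by (simp add: P.padic_rel_def)
qed

lemma padic_eqI:
  assumes "padic_rat.cauchy CARD('p::prime_card) X" "padic_rat.cauchy CARD('p) Y"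
    "padic_rat.vanishes CARD('p) (\<lambda>n. X n - Y n)"
  shows "padic_of_seq X = (padic_of_seq Y :: 'p padic)"
  using padic_of_seq_eq_iff assms by blast

lemma padic_rep_of_seq:
  assumes "padic_rat.cauchy CARD('p::prime_card) X"
  shows "padic_rat.vanishes CARD('p) (\<lambda>n. padic_rep (padic_of_seq X :: 'p padic) n - X n)"
  using padic_of_seq_eq_iff[OF padic_rep(1) assms] padic_rep(2) by blast

lemma padic_cases:
  fixes x :: "'p::prime_card padic"
  obtains X where "padic_rat.cauchy CARD('p) X" "x = padic_of_seq X"
  using padic_rep[of x] by metis

instantiation padic :: (prime_card) field
begin

definition "0 = padic_of_seq (\<lambda>n. 0)"
definition "1 = padic_of_seq (\<lambda>n. 1)"
definition "x + y = padic_of_seq (\<lambda>n. padic_rep x n + padic_rep y n)"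
definition "- x = padic_of_seq (\<lambda>n. - padic_rep x n)"
definition "(x :: 'a padic) - y = x + - y"
definition "x * y = padic_of_seq (\<lambda>n. padic_rep x n * padic_rep y n)"
definition "inverse x = (if x = 0 then 0 else padic_of_seq (\<lambda>n. inverse (padic_rep x n)))"
definition "(x :: 'a padic) div y = x * inverse y"

lemma padic_add:
  assumes "padic_rat.cauchy CARD('a) X" "padic_rat.cauchy CARD('a) Y"
  shows "padic_of_seq X + padic_of_seq Y = (padic_of_seq (\<lambda>n. X n + Y n) :: 'a padic)"
  unfolding plus_padic_def
  using P.vanishes_add[OF padic_rep_of_seq[OF assms(1)] padic_rep_of_seq[OF assms(2)]]
  by (intro padic_eqI) (simp_all add: assms padic_rep add_diff_add)

lemma padic_minus:
  assumes "padic_rat.cauchy CARD('a) X"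
  shows "- padic_of_seq X = (padic_of_seq (\<lambda>n. - X n) :: 'a padic)"
  unfolding uminus_padic_def
  using P.vanishes_minus[OF padic_rep_of_seq[OF assms(1)]]
  by (intro padic_eqI) (simp_all add: assms padic_rep)

lemma padic_diff:
  assumes "padic_rat.cauchy CARD('a) X" "padic_rat.cauchy CARD('a) Y"
  shows "padic_of_seq X - padic_of_seq Y = (padic_of_seq (\<lambda>n. X n - Y n) :: 'a padic)"
  by (simp add: minus_padic_def padic_minus padic_add assms)

lemma padic_mult:
  assumes "padic_rat.cauchy CARD('a) X" "padic_rat.cauchy CARD('a) Y"
  shows "padic_of_seq X * padic_of_seq Y = (padic_of_seq (\<lambda>n. X n * Y n) :: 'a padic)"
proof -
  let ?U = "padic_rep (padic_of_seq X :: 'a padic)" and ?V = "padic_rep (padic_of_seq Y :: 'a padic)"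
  have "P.vanishes TYPE('a) (\<lambda>n. ?U n * (?V n - Y n))"
    by (intro P.vanishes_mult_bounded padic_rep padic_rep_of_seq assms)
  moreover have "P.vanishes TYPE('a) (\<lambda>n. Y n * (?U n - X n))"
    by (intro P.vanishes_mult_bounded padic_rep padic_rep_of_seq assms)
  ultimately have "P.vanishes TYPE('a) (\<lambda>n. ?U n * (?V n - Y n) + Y n * (?U n - X n))"
    by (rule P.vanishes_add)
  then have "P.vanishes TYPE('a) (\<lambda>n. ?U n * ?V n - X n * Y n)"
    by (simp add: algebra_simps)
  then show ?thesis unfolding times_padic_def
    by (intro padic_eqI) (simp_all add: assms padic_rep)
qed

lemma padic_of_seq_0_iff:
  assumes "padic_rat.cauchy CARD('a) X"
  shows "padic_of_seq X = (0 :: 'a padic) \<longleftrightarrow> padic_rat.vanishes CARD('a) X"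
  unfolding zero_padic_def using padic_of_seq_eq_iff[OF assms, of "\<lambda>n. 0"] by simp

lemma padic_inverse:
  assumes "padic_rat.cauchy CARD('a) X" "\<not> padic_rat.vanishes CARD('a) X"
  shows "inverse (padic_of_seq X) = (padic_of_seq (\<lambda>n. inverse (X n)) :: 'a padic)"
proof -
  let ?x = "padic_of_seq X :: 'a padic"
  have nz: "?x \<noteq> 0" using padic_of_seq_0_iff[OF assms(1)] assms(2) by simp
  then have nv: "\<not> P.vanishes TYPE('a) (padic_rep ?x)"
    using padic_of_seq_0_iff[OF padic_rep(1)[of ?x]] padic_rep(2)[of ?x] by simp
  have "padic_of_seq (\<lambda>n. inverse (padic_rep ?x n)) = (padic_of_seq (\<lambda>n. inverse (X n)) :: 'a padic)"
    by (intro padic_eqI P.cauchy_inverse P.vanishes_diff_inverse padic_rep padic_rep_of_seq nv assms)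
  then show ?thesis using nz by (simp add: inverse_padic_def)
qed

instance
proof
  fix a b c :: "'a padic"
  obtain X where X: "P.cauchy TYPE('a) X" "a = padic_of_seq X" by (rule padic_cases)
  obtain Y where Y: "P.cauchy TYPE('a) Y" "b = padic_of_seq Y" by (rule padic_cases)
  obtain Z where Z: "P.cauchy TYPE('a) Z" "c = padic_of_seq Z" by (rule padic_cases)
  note s = X Y Z zero_padic_def one_padic_def padic_add padic_minus padic_mult
  show "a + b + c = a + (b + c)" by (simp add: s add.assoc)
  show "a + b = b + a" by (simp add: s add.commute)
  show "0 + a = a" by (simp add: s)
  show "- a + a = 0" by (simp add: s)
  show "a - b = a + - b" by (rule minus_padic_def)
  show "a * b * c = a * (b * c)" by (simp add: s mult.assoc)
  show "a * b = b * a" by (simp add: s mult.commute)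
  show "1 * a = a" by (simp add: s)
  show "(a + b) * c = a * c + b * c" by (simp add: s distrib_right)
  show "(0 :: 'a padic) \<noteq> 1"
    using padic_of_seq_0_iff[of "\<lambda>n. 1"] by (simp add: one_padic_def eq_commute[of 0])
  show "a div b = a * inverse b" by (rule divide_padic_def)
  show "inverse (0 :: 'a padic) = 0" by (simp add: inverse_padic_def)
  show "inverse a * a = 1" if "a \<noteq> 0"
  proof -
    have nv: "\<not> P.vanishes TYPE('a) X"
      using that X padic_of_seq_0_iff by blast
    obtain e k where "e > 0" and k: "\<And>n. n \<ge> k \<Longrightarrow> e < P.N TYPE('a) (X n)"
      by (rule P.cauchy_not_vanishes[OF X(1) nv]) blast
    have nz: "X n \<noteq> 0" if "n \<ge> k" for n
      using k[OF that] \<open>e > 0\<close> by auto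
    have "eventually (\<lambda>n. P.N TYPE('a) (inverse (X n) * X n - 1) = 0) sequentially"
      using eventually_ge_at_top[of k] by eventually_elim (simp add: nz)
    then have v: "P.vanishes TYPE('a) (\<lambda>n. inverse (X n) * X n - 1)"
      unfolding P.vanishes_def by (rule tendsto_eventually)
    have "inverse a * a = padic_of_seq (\<lambda>n. inverse (X n) * X n)"
      using X nv by (simp add: padic_inverse padic_mult)
    also have "\<dots> = 1" unfolding one_padic_def
      by (rule padic_eqI[OF _ _ v]) (use X(1) nv in simp_all)
    finally show ?thesis .
  qed
qed

end

lemma padic_of_nat: "(of_nat k :: 'p::prime_card padic) = padic_of_seq (\<lambda>n. of_nat k)"
  by (induction k) (simp_all add: zero_padic_def one_padic_def padic_add)

instance padic :: (prime_card) field_char_0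
proof
  show "inj (of_nat :: nat \<Rightarrow> 'a padic)"
  proof (rule injI)
    fix j k assume "of_nat j = (of_nat k :: 'a padic)"
    then have "P.vanishes TYPE('a) (\<lambda>n. of_nat j - of_nat k)"
      by (simp add: padic_of_nat padic_of_seq_eq_iff)
    then show "j = k" by simp
  qed
qed

lemma padic_of_int: "(of_int k :: 'p::prime_card padic) = padic_of_seq (\<lambda>n. of_int k)"
  by (cases k rule: int_diff_cases) (simp add: padic_of_nat padic_diff)

lemma padic_of_rat: "(of_rat q :: 'p::prime_card padic) = padic_of_seq (\<lambda>n. q)"
proof -
  obtain a b where q: "quotient_of q = (a, b)" by (cases "quotient_of q")
  then have e: "q = of_int a / of_int b" and b: "b > 0"
    using quotient_of_div quotient_of_denom_pos by auto
  have "padic_of_seq (\<lambda>n. q) * of_int b = (of_int a :: 'p padic)"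
    using b by (simp add: padic_of_int padic_mult e)
  moreover have "of_rat q * of_int b = (of_int a :: 'p padic)"
    using b by (simp add: e of_rat_divide)
  ultimately have "padic_of_seq (\<lambda>n. q) * of_int b = (of_rat q * of_int b :: 'p padic)" by simp
  then show ?thesis using b by simp
qed


section \<open>The \<open>p\<close>-adic absolute value and topology\<close>

definition padic_abs :: "'p::prime_card padic \<Rightarrow> real" where
  "padic_abs x = lim (\<lambda>n. padic_abs_rat CARD('p) (padic_rep x n))"

lemma padic_abs_of_seq:
  assumes "padic_rat.cauchy CARD('p::prime_card) X"
  shows "padic_abs (padic_of_seq X :: 'p padic) = lim (\<lambda>n. padic_abs_rat CARD('p) (X n))"
    and "(\<lambda>n. padic_abs_rat CARD('p) (X n)) \<longlonglongrightarrow> padic_abs (padic_of_seq X :: 'p padic)"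
proof -
  show e: "padic_abs (padic_of_seq X :: 'p padic) = lim (\<lambda>n. padic_abs_rat CARD('p) (X n))"
    unfolding padic_abs_def using padic_rep_of_seq[OF assms] padic_rep(1) assms
    by (intro P.padic_rel_lim) (simp add: P.padic_rel_def)
  show "(\<lambda>n. padic_abs_rat CARD('p) (X n)) \<longlonglongrightarrow> padic_abs (padic_of_seq X :: 'p padic)"
    unfolding e using P.cauchy_convergent[OF assms] by (simp add: convergent_LIMSEQ_iff)
qed

lemma padic_abs_eq_0_iff: "padic_abs (x :: 'p::prime_card padic) = 0 \<longleftrightarrow> x = 0"
proof -
  obtain X where X: "P.cauchy TYPE('p) X" "x = padic_of_seq X" by (rule padic_cases)
  have l: "(\<lambda>n. P.N TYPE('p) (X n)) \<longlonglongrightarrow> padic_abs x" using padic_abs_of_seq(2) X by blast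
  have "padic_abs x = 0 \<longleftrightarrow> P.vanishes TYPE('p) X"
  proof
    assume "padic_abs x = 0"
    with l show "P.vanishes TYPE('p) X" unfolding P.vanishes_def by simp
  next
    assume "P.vanishes TYPE('p) X"
    then show "padic_abs x = 0" unfolding P.vanishes_def by (rule LIMSEQ_unique[OF l])
  qed
  then show ?thesis unfolding X(2) padic_of_seq_0_iff[OF X(1)] .
qed

lemma padic_abs_mult: "padic_abs (x * y :: 'p::prime_card padic) = padic_abs x * padic_abs y"
proof -
  obtain X where X: "P.cauchy TYPE('p) X" "x = padic_of_seq X" by (rule padic_cases)
  obtain Y where Y: "P.cauchy TYPE('p) Y" "y = padic_of_seq Y" by (rule padic_cases)
  have "(\<lambda>n. P.N TYPE('p) (X n * Y n)) \<longlonglongrightarrow> padic_abs x * padic_abs y"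
    unfolding P.N_mult X(2) Y(2) by (intro tendsto_mult padic_abs_of_seq X Y)
  moreover have "(\<lambda>n. P.N TYPE('p) (X n * Y n)) \<longlonglongrightarrow> padic_abs (x * y)"
    using padic_abs_of_seq(2)[OF P.cauchy_mult[OF X(1) Y(1)]] X Y by (simp add: padic_mult)
  ultimately show ?thesis using LIMSEQ_unique by blast
qed

lemma padic_abs_add: "padic_abs (x + y :: 'p::prime_card padic) \<le> max (padic_abs x) (padic_abs y)"
proof -
  obtain X where X: "P.cauchy TYPE('p) X" "x = padic_of_seq X" by (rule padic_cases)
  obtain Y where Y: "P.cauchy TYPE('p) Y" "y = padic_of_seq Y" by (rule padic_cases)
  have 1: "(\<lambda>n. max (P.N TYPE('p) (X n)) (P.N TYPE('p) (Y n))) \<longlonglongrightarrow> max (padic_abs x) (padic_abs y)"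
    unfolding X(2) Y(2) by (intro tendsto_max padic_abs_of_seq X Y)
  have 2: "(\<lambda>n. P.N TYPE('p) (X n + Y n)) \<longlonglongrightarrow> padic_abs (x + y)"
    using padic_abs_of_seq(2)[OF P.cauchy_add[OF X(1) Y(1)]] X Y by (simp add: padic_add)
  show ?thesis by (rule LIMSEQ_le[OF 2 1]) (auto intro: P.N_add)
qed

lemma padic_abs_nonneg: "padic_abs (x :: 'p::prime_card padic) \<ge> 0"
proof -
  obtain X where X: "P.cauchy TYPE('p) X" "x = padic_of_seq X" by (rule padic_cases)
  show ?thesis unfolding X(2)
    by (rule LIMSEQ_le_const[OF padic_abs_of_seq(2)[OF X(1)]]) auto
qed

lemma padic_abs_of_rat: "padic_abs (of_rat q :: 'p::prime_card padic) = padic_abs_rat CARD('p) q"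
  using padic_abs_of_seq(1)[of "\<lambda>n. q"] by (simp add: padic_of_rat)

lemma padic_abs_minus: "padic_abs (- x :: 'p::prime_card padic) = padic_abs x"
  using padic_abs_mult[of "of_rat (-1)" x] by (simp add: padic_abs_of_rat del: of_rat_neg_one)
     (simp add: of_rat_minus)

instantiation padic :: (prime_card) metric_space
begin

definition dist_padic_def: "dist x y = padic_abs (x - y :: 'a padic)"

definition uniformity_padic_def:
  "(uniformity :: ('a padic \<times> 'a padic) filter) = (INF e\<in>{0<..}. principal {(x, y). dist x y < e})"

definition open_padic_def:
  "open (U :: 'a padic set) \<longleftrightarrow> (\<forall>x\<in>U. eventually (\<lambda>(x', y). x' = x \<longrightarrow> y \<in> U) uniformity)"

instance
proof
  fix x y z :: "'a padic"
  show "dist x y = 0 \<longleftrightarrow> x = y" by (simp add: dist_padic_def padic_abs_eq_0_iff)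
  have "padic_abs (x - y) \<le> max (padic_abs (x - z)) (padic_abs (y - z))"
    using padic_abs_add[of "x - z" "- (y - z)"] padic_abs_minus[of "y - z"] by simp
  then show "dist x y \<le> dist x z + dist y z"
    using padic_abs_nonneg[of "x - z"] padic_abs_nonneg[of "y - z"]
    unfolding dist_padic_def by linarith
qed (simp_all add: uniformity_padic_def open_padic_def)

end

lemma padic_rat_dense:
  fixes x :: "'p::prime_card padic"
  assumes "e > 0"
  obtains q where "dist x (of_rat q) < e"
proof -
  obtain X where X: "P.cauchy TYPE('p) X" "x = padic_of_seq X" by (rule padic_cases)
  obtain k where k: "\<forall>m\<ge>k. \<forall>n\<ge>k. P.N TYPE('p) (X m - X n) < e / 2"
    using X(1) half_gt_zero[OF assms] unfolding P.cauchy_def by blast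
  have c: "P.cauchy TYPE('p) (\<lambda>n. X n - X k)" using X by simp
  have "x - of_rat (X k) = padic_of_seq (\<lambda>n. X n - X k)"
    using X by (simp add: padic_of_rat padic_diff)
  then have l: "(\<lambda>n. P.N TYPE('p) (X n - X k)) \<longlonglongrightarrow> dist x (of_rat (X k))"
    unfolding dist_padic_def using padic_abs_of_seq(2)[OF c] by simp
  have "dist x (of_rat (X k)) \<le> e / 2"
    by (rule LIMSEQ_le_const2[OF l]) (use k in \<open>auto intro!: exI[of _ k] less_imp_le\<close>)
  then show ?thesis using assms that[of "X k"] by simp
qed

instance padic :: (prime_card) complete_space
proof
  fix S :: "nat \<Rightarrow> 'a padic"
  assume S: "Cauchy S"
  have "\<exists>q. dist (S n) (of_rat q) < 1 / real (Suc n)" for n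
    using padic_rat_dense[of "1 / real (Suc n)" "S n"] by fastforce
  then obtain Q where Q: "\<And>n. dist (S n) (of_rat (Q n)) < 1 / real (Suc n)" by metis
  have z: "(\<lambda>n. dist (S n) (of_rat (Q n))) \<longlonglongrightarrow> 0"
    by (rule tendsto_sandwich[OF _ _ tendsto_const LIMSEQ_inverse_real_of_nat])
       (use Q in \<open>simp_all add: inverse_eq_divide less_imp_le\<close>)
  have N: "P.N TYPE('a) (Q m - Q n) = dist (of_rat (Q m)) (of_rat (Q n) :: 'a padic)" for m n
    by (simp add: dist_padic_def padic_abs_of_rat flip: of_rat_diff)
  have c: "P.cauchy TYPE('a) Q"
    unfolding P.cauchy_def
  proof (intro allI impI)
    fix e :: real assume e: "e > 0"
    then have e3: "e / 3 > 0" by simp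
    obtain k where k: "\<And>m n. m \<ge> k \<Longrightarrow> n \<ge> k \<Longrightarrow> dist (S m) (S n) < e / 3"
      using metric_CauchyD[OF S e3] by blast
    obtain l where l: "\<And>n. n \<ge> l \<Longrightarrow> dist (S n) (of_rat (Q n)) < e / 3"
      using order_tendstoD(2)[OF z e3] unfolding eventually_sequentially by blast
    have "P.N TYPE('a) (Q m - Q n) < e" if "m \<ge> max k l" "n \<ge> max k l" for m n
    proof -
      have "dist (of_rat (Q m)) (of_rat (Q n) :: 'a padic)
          \<le> dist (S m) (of_rat (Q m)) + dist (S m) (S n) + dist (S n) (of_rat (Q n))"
        using dist_triangle[of "of_rat (Q m)" "of_rat (Q n)" "S m"]
          dist_triangle[of "S m" "of_rat (Q n)" "S n"] by (simp add: dist_commute)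
      moreover have "dist (S m) (of_rat (Q m)) < e / 3" "dist (S m) (S n) < e / 3"
        "dist (S n) (of_rat (Q n)) < e / 3"
        using k[of m n] l[of m] l[of n] that by auto
      ultimately show ?thesis unfolding N by linarith
    qed
    then show "\<exists>k. \<forall>m\<ge>k. \<forall>n\<ge>k. P.N TYPE('a) (Q m - Q n) < e" by blast
  qed
  define x :: "'a padic" where "x = padic_of_seq Q"
  have "(\<lambda>n. dist (of_rat (Q n)) x) \<longlonglongrightarrow> 0"
  proof (rule LIMSEQ_I)
    fix e :: real assume e: "e > 0"
    obtain k where k: "\<forall>m\<ge>k. \<forall>n\<ge>k. P.N TYPE('a) (Q m - Q n) < e / 2"
      using c half_gt_zero[OF e] unfolding P.cauchy_def by blast
    have "norm (dist (of_rat (Q n)) x - 0) < e" if n: "n \<ge> k" for n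
    proof -
      have c': "P.cauchy TYPE('a) (\<lambda>m. Q n - Q m)" using c by simp
      have "of_rat (Q n) - x = padic_of_seq (\<lambda>m. Q n - Q m)"
        using c by (simp add: x_def padic_of_rat padic_diff)
      then have l: "(\<lambda>m. P.N TYPE('a) (Q n - Q m)) \<longlonglongrightarrow> dist (of_rat (Q n)) x"
        unfolding dist_padic_def using padic_abs_of_seq(2)[OF c'] by simp
      have "dist (of_rat (Q n)) x \<le> e / 2"
        by (rule LIMSEQ_le_const2[OF l]) (use k n in \<open>auto intro!: exI[of _ k] less_imp_le\<close>)
      then show ?thesis using e by simp
    qed
    then show "\<exists>k. \<forall>n\<ge>k. norm (dist (of_rat (Q n)) x - 0) < e" by blast
  qed
  from tendsto_add[OF z this]
  have l: "(\<lambda>n. dist (S n) (of_rat (Q n)) + dist (of_rat (Q n)) x) \<longlonglongrightarrow> 0" by simp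
  have "(\<lambda>n. dist (S n) x) \<longlonglongrightarrow> 0"
    by (rule tendsto_sandwich[OF _ _ tendsto_const l])
       (intro always_eventually allI zero_le_dist dist_triangle)+
  then have "S \<longlonglongrightarrow> x" by (subst tendsto_dist_iff)
  then show "convergent S" by (rule convergentI)
qed


section \<open>Haar measure\<close>

text \<open>Borel measures on \<open>'p padic\<close> that are finite on compact sets are automatically regular, so
  translation invariance and the value on the unit ball determine the Haar measure.\<close>

definition is_haar :: "'p::prime_card padic measure \<Rightarrow> bool" where
  "is_haar M \<longleftrightarrow> sets M = sets borel
     \<and> (\<forall>a. \<forall>A\<in>sets borel. emeasure M ((\<lambda>x. a + x) ` A) = emeasure M A)
     \<and> emeasure M {x. padic_abs x \<le> 1} = 1"

definition padic_ball :: "int \<Rightarrow> 'p::prime_card padic set" where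
  "padic_ball n = {x. padic_abs x \<le> real CARD('p) powi n}"


section \<open>Block spaces on the nonzero \<open>p\<close>-adic numbers\<close>

text \<open>Functions on the nonzero \<open>p\<close>-adic numbers are total functions on \<open>'p padic\<close>;
  every notion below ignores the value at \<open>0\<close>.\<close>

definition in_Lr :: "'p::prime_card padic measure \<Rightarrow> real \<Rightarrow> ('p padic \<Rightarrow> complex) \<Rightarrow> bool" where
  "in_Lr M r f \<longleftrightarrow> set_borel_measurable M (- {0}) f
     \<and> set_integrable M (- {0}) (\<lambda>x. norm (f x) powr r)"

definition Lr_norm :: "'p::prime_card padic measure \<Rightarrow> real \<Rightarrow> ('p padic \<Rightarrow> complex) \<Rightarrow> real" where
  "Lr_norm M r f = (LINT x:- {0}|M. norm (f x) powr r) powr (1 / r)"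

definition in_Lr_loc :: "'p::prime_card padic measure \<Rightarrow> real \<Rightarrow> ('p padic \<Rightarrow> complex) \<Rightarrow> bool" where
  "in_Lr_loc M r f \<longleftrightarrow> set_borel_measurable M (- {0}) f
     \<and> (\<forall>K. compact K \<and> K \<subseteq> - {0} \<longrightarrow> set_integrable M K (\<lambda>x. norm (f x) powr r))"

text \<open>The balls are closed, so the support of \<open>a\<close> lies in a ball as soon as the set where
  \<open>a\<close> is nonzero does.\<close>

definition central_block ::
    "'p::prime_card padic measure \<Rightarrow> real \<Rightarrow> real \<Rightarrow> ('p padic \<Rightarrow> complex) \<Rightarrow> bool" where
  "central_block M r \<alpha> a \<longleftrightarrow> in_Lr M r a \<and>
     (\<exists>n::int. {x. x \<noteq> 0 \<and> a x \<noteq> 0} \<subseteq> padic_ball n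
        \<and> Lr_norm M r a \<le> measure M (padic_ball n :: 'p padic set) powr (- \<alpha>))"

definition block_decomp :: "'p::prime_card padic measure \<Rightarrow> real \<Rightarrow> real \<Rightarrow> ('p padic \<Rightarrow> complex)
    \<Rightarrow> (nat \<Rightarrow> complex) \<Rightarrow> (nat \<Rightarrow> 'p padic \<Rightarrow> complex) \<Rightarrow> bool" where
  "block_decomp M r \<alpha> f l a \<longleftrightarrow> summable (\<lambda>k. norm (l k))
     \<and> (\<forall>k. central_block M r \<alpha> (a k))
     \<and> (AE x in M. x \<noteq> 0 \<longrightarrow> (\<lambda>k. l k * a k x) sums f x)"

definition block_space ::
    "'p::prime_card padic measure \<Rightarrow> real \<Rightarrow> real \<Rightarrow> ('p padic \<Rightarrow> complex) set" where
  "block_space M r \<alpha> = {f. in_Lr_loc M r f \<and> (\<exists>l a. block_decomp M r \<alpha> f l a)}"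

definition block_norm ::
    "'p::prime_card padic measure \<Rightarrow> real \<Rightarrow> real \<Rightarrow> ('p padic \<Rightarrow> complex) \<Rightarrow> real" where
  "block_norm M r \<alpha> f = Inf {\<Sum>k. norm (l k) | l a. block_decomp M r \<alpha> f l a}"


section \<open>The \<open>p\<close>-adic Hilbert operator\<close>

definition hilbert_integrand ::
    "('p::prime_card padic \<Rightarrow> complex) \<Rightarrow> 'p padic \<Rightarrow> 'p padic \<Rightarrow> complex" where
  "hilbert_integrand f x y = f y / of_real (padic_abs x + padic_abs y)"

definition hilbert_op ::
    "'p::prime_card padic measure \<Rightarrow> ('p padic \<Rightarrow> complex) \<Rightarrow> 'p padic \<Rightarrow> complex" where
  "hilbert_op M f x = (LINT y:- {0}|M. hilbert_integrand f x y)"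

end

theory Submission
  imports Defs "HOL-Number_Theory.Cong"
begin

text \<open>
  No boundedness of the operator on \<open>L\<^sup>r\<close> (Hardy or Hilbert inequality) is needed.
  If \<open>a\<close> is a block on the ball of radius \<open>q\<^sup>n\<close> and \<open>\<bar>x\<bar> = q\<^sup>j\<close>, then
  \<open>\<integral> \<bar>a y\<bar> / (\<bar>x\<bar> + \<bar>y\<bar>) dy\<close> is at most a constant times
  \<open>\<bar>x\<bar> powr - (1/r + \<alpha>)\<close> with a gain of \<open>q powr - (\<delta> * \<bar>j - n\<bar>)\<close>, where
  \<open>\<delta> = min \<alpha> (1 - 1/r - \<alpha>) > 0\<close>.  Hence, if \<open>f = (\<Sum>k. l k * a k)\<close> with \<open>a k\<close> a block on the ball of
  radius \<open>q\<close> to the \<open>n k\<close>, the restriction of the transform of \<open>f\<close> to the sphere of radius \<open>q\<^sup>j\<close> is a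
  multiple of a block, with coefficient \<open>L j\<close> at most a constant times the convolution
  \<open>\<Sum>k. \<bar>l k\<bar> * q powr - (\<delta> * \<bar>j - n k\<bar>)\<close>, and the \<open>L j\<close> are summable over the integers.
\<close>

section \<open>Spheres, balls and residues\<close>

lemma padic_abs_eq_dist: "padic_abs x = dist x (0 :: 'p::prime_card padic)"
  by (simp add: dist_padic_def)

lemma padic_abs_0 [simp]: "padic_abs (0 :: 'p::prime_card padic) = 0"
  by (simp add: padic_abs_eq_0_iff)

lemma padic_abs_1: "padic_abs (1 :: 'p::prime_card padic) = 1"
  using padic_abs_of_rat[of 1, where 'p='p] by simp

lemma padic_abs_inverse: "padic_abs (inverse x :: 'p::prime_card padic) = inverse (padic_abs x)"
proof (cases "x = 0")
  case False
  then have "padic_abs x * padic_abs (inverse x) = 1"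
    by (simp add: padic_abs_1 flip: padic_abs_mult)
  then show ?thesis by (metis inverse_unique)
qed simp

lemma padic_abs_power: "padic_abs (x ^ k :: 'p::prime_card padic) = padic_abs x ^ k"
  by (induction k) (simp_all add: padic_abs_1 padic_abs_mult)

lemma padic_abs_power_int: "padic_abs (x powi n :: 'p::prime_card padic) = padic_abs x powi n"
  by (simp add: power_int_def padic_abs_power padic_abs_inverse)

lemma padic_abs_diff: "padic_abs (x - y :: 'p::prime_card padic) \<le> max (padic_abs x) (padic_abs y)"
  using padic_abs_add[of x "- y"] by (simp add: padic_abs_minus)

lemma padic_abs_diff_commute: "padic_abs (x - y :: 'p::prime_card padic) = padic_abs (y - x)"
  using padic_abs_minus[of "x - y"] by simp

text \<open>Isosceles principle: writing \<open>y\<close> as \<open>x - (x - y)\<close> and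
  \<open>x\<close> as \<open>(x - y) + y\<close> gives both inequalities, because the small side
  cannot attain the maximum.\<close>

lemma padic_abs_eq_if_close:
  fixes x y :: "'p::prime_card padic"
  assumes "padic_abs (x - y) < padic_abs x"
  shows "padic_abs y = padic_abs x"
  using padic_abs_diff[of x "x - y"] padic_abs_add[of "x - y" y] assms by (simp add: max_def split: if_splits)

text \<open>A rational closer to \<open>x\<close> than \<open>padic_abs x\<close> has the same
  absolute value by the isosceles principle, and on rationals the values are powers of
  \<open>p\<close> by definition.\<close>

lemma padic_abs_powi:
  fixes x :: "'p::prime_card padic"
  assumes "x \<noteq> 0"
  obtains n where "padic_abs x = real CARD('p) powi n"
proof -
  have "padic_abs x > 0"
    using assms padic_abs_nonneg[of x] padic_abs_eq_0_iff[of x] by linarith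
  then obtain q where q: "dist x (of_rat q) < padic_abs x"
    by (rule padic_rat_dense)
  then have e: "padic_abs (of_rat q :: 'p padic) = padic_abs x"
    by (intro padic_abs_eq_if_close) (simp add: dist_padic_def)
  moreover have "q \<noteq> 0" using q by (auto simp: dist_padic_def)
  ultimately show ?thesis
    using that by (metis padic_abs_of_rat padic_abs_rat_def)
qed

text \<open>Discreteness of the value group: nothing lies strictly between consecutive powers of
  \<open>p\<close>, so a strict bound improves by a whole factor \<open>p\<close>.\<close>

lemma padic_abs_less_imp_le:
  fixes x :: "'p::prime_card padic"
  assumes "padic_abs x < real CARD('p) powi (n + 1)"
  shows "padic_abs x \<le> real CARD('p) powi n"
proof (cases "x = 0")
  case True
  then show ?thesis by simp
next
  case False
  then obtain m where m: "padic_abs x = real CARD('p) powi m" by (rule padic_abs_powi)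
  have "m < n + 1"
    using power_int_increasing[of "n + 1" m "real CARD('p)"] P.p_gt_1[where 'p='p] assms m
    by fastforce
  then show ?thesis unfolding m using P.p_gt_1[where 'p='p] by (intro power_int_increasing) auto
qed

section \<open>Residues modulo \<open>p\<close> of the unit ball\<close>

lemma padic_abs_of_int:
  "padic_abs (of_int k :: 'p::prime_card padic) = padic_abs_rat CARD('p) (of_int k)"
  using padic_abs_of_rat[of "of_int k", where 'p='p] by simp

lemma padic_abs_rat_of_int_eq_1:
  assumes "\<not> int CARD('p::prime_card) dvd k"
  shows "padic_abs_rat CARD('p) (of_int k) = 1"
proof -
  have "k \<noteq> 0" using assms by auto
  then show ?thesis
    using P.N_Fract[of k 1, where 'p='p] assms by (simp add: not_dvd_imp_multiplicity_0)
qed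

lemma padic_abs_rat_of_int_less_1:
  assumes "int CARD('p::prime_card) dvd k"
  shows "padic_abs_rat CARD('p) (of_int k) < 1"
proof (cases "k = 0")
  case False
  have "1 \<le> multiplicity (int CARD('p)) k"
    using assms False P.prime_int_p[where 'p='p] by (intro multiplicity_geI) (auto simp: not_prime_unit)
  then have "real CARD('p) powi (- int (multiplicity (int CARD('p)) k)) \<le> real CARD('p) powi (-1)"
    using P.p_gt_1[where 'p='p] by (intro power_int_increasing) auto
  also have "\<dots> < 1"  using P.p_gt_1[where 'p='p] by (simp add: field_simps)
  finally show ?thesis using False P.N_Fract[of k 1, where 'p='p] by simp
qed auto

text \<open>Approximate \<open>z\<close> by a reduced fraction \<open>q = a / b\<close> with error
  below 1. Then \<open>p\<close> does not divide \<open>b\<close>, so \<open>b\<close> is a unit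
  modulo \<open>p\<close>, and \<open>k\<close> is the residue of \<open>a / b\<close>.\<close>

lemma padic_residue:
  fixes z :: "'p::prime_card padic"
  assumes "padic_abs z \<le> 1"
  obtains k where "k < CARD('p)" "padic_abs (z - of_nat k) < 1"
proof -
  let ?p = "int CARD('p)"
  obtain q where q: "dist z (of_rat q) < 1" by (rule padic_rat_dense[of 1]) auto
  have "padic_abs (of_rat q :: 'p padic) \<le> 1"
    using padic_abs_diff[of z "z - of_rat q"] q assms by (simp add: dist_padic_def)
  then have Nq: "P.N TYPE('p) q \<le> 1" by (simp add: padic_abs_of_rat)
  obtain a b where ab: "quotient_of q = (a, b)" by (cases "quotient_of q")
  have b: "b > 0" and cop: "coprime a b" and qab: "q = of_int a / of_int b"
    using quotient_of_denom_pos[OF ab] quotient_of_coprime[OF ab] quotient_of_div[OF ab] by auto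
  \<comment> \<open>If \<open>p\<close> divided \<open>b\<close>, coprimality would make
    \<open>a\<close> a unit of absolute value 1, while \<open>a = q * b\<close> has absolute value
    below 1.\<close>
  have nb: "\<not> ?p dvd b"
  proof
    assume d: "?p dvd b"
    then have na: "\<not> ?p dvd a"
      using cop P.prime_int_p[where 'p='p] by (meson coprime_common_divisor not_prime_unit)
    have "P.N TYPE('p) (of_int a) = P.N TYPE('p) q * P.N TYPE('p) (of_int b)"
      using b by (simp add: qab flip: P.N_mult)
    also have "\<dots> \<le> P.N TYPE('p) (of_int b)" using Nq by (intro mult_left_le_one_le) auto
    also have "\<dots> < 1" using d by (rule padic_abs_rat_of_int_less_1)
    finally show False using padic_abs_rat_of_int_eq_1[OF na] by simp
  qed
  then have "coprime b ?p"
    using P.prime_int_p[where 'p='p] by (metis coprime_commute prime_imp_coprime)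
  then obtain c where c: "[b * c = 1] (mod ?p)" using cong_solve_coprime_int by blast
  define k where "k = nat ((a * c) mod ?p)"
  have p0: "?p > 0" using P.p_gt_1[where 'p='p] by simp
  have k: "int k = (a * c) mod ?p" using p0 by (simp add: k_def)
  have kp: "k < CARD('p)" using p0 k by (metis of_nat_less_iff pos_mod_bound)
  have "[a - b * int k = a - b * (a * c)] (mod ?p)"
    unfolding k by (intro cong_diff cong_mult) (auto simp: cong_def)
  also have "a - b * (a * c) = a - a * (b * c)" by simp
  also have "[\<dots> = a - a * 1] (mod ?p)" by (intro cong_diff cong_mult c) auto
  finally have "?p dvd a - b * int k" by (simp add: cong_0_iff)
  then have "P.N TYPE('p) (of_int (a - b * int k)) < 1" by (rule padic_abs_rat_of_int_less_1)
  \<comment> \<open>Since \<open>b\<close> has absolute value 1, the divisibility of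
    \<open>a - b * int k\<close> by \<open>p\<close> passes to the smallness of
    \<open>q - of_nat k\<close>.\<close>
  also have "of_int (a - b * int k) = of_int b * (q - of_nat k)"
    using b by (simp add: qab field_simps)
  finally have "P.N TYPE('p) (q - of_nat k) < 1"
    by (simp only: P.N_mult padic_abs_rat_of_int_eq_1[OF nb])
  then have "padic_abs (of_rat q - of_nat k :: 'p padic) < 1"
    using padic_abs_of_rat[of "q - of_nat k", where 'p='p] by (simp add: of_rat_diff)
  then have "padic_abs (z - of_nat k) < 1"
    using padic_abs_add[of "z - of_rat q" "of_rat q - of_nat k"] q by (simp add: dist_padic_def)
  with kp show ?thesis by (rule that)
qed

text \<open>A nonzero integer of modulus below \<open>p\<close> is prime to \<open>p\<close>. This
  separates the residue classes that split a ball.\<close>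

lemma padic_abs_of_nat_diff:
  assumes "j < CARD('p::prime_card)" "k < CARD('p)" "j \<noteq> k"
  shows "padic_abs (of_nat j - of_nat k :: 'p padic) = 1"
proof -
  have "\<not> int CARD('p) dvd int j - int k"
    using assms zdvd_imp_le[of "int CARD('p)" "\<bar>int j - int k\<bar>"] by auto
  from padic_abs_rat_of_int_eq_1[OF this] show ?thesis
    using padic_abs_of_int[of "int j - int k", where 'p='p] by simp
qed

section \<open>Splitting a ball into \<open>p\<close> translates of the next smaller one\<close>

lemma ex_padic_abs_eq: "\<exists>w :: 'p::prime_card padic. padic_abs w = real CARD('p) powi n"
proof
  have "padic_abs (of_int (int CARD('p)) :: 'p padic) = inverse (real CARD('p))"
    using P.N_Fract[of "int CARD('p)" 1, where 'p='p] P.p_pos[where 'p='p]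
      multiplicity_self[of "int CARD('p)"] P.prime_int_p[where 'p='p] not_prime_unit
    unfolding padic_abs_of_int by (auto simp: power_int_minus)
  \<comment> \<open>The witness is \<open>p\<close> to the power \<open>- n\<close>, since
    \<open>p\<close> itself has absolute value \<open>1 / p\<close>.\<close>
  then show "padic_abs (of_nat CARD('p) powi (- n) :: 'p padic) = real CARD('p) powi n"
    by (simp add: padic_abs_power_int power_int_minus padic_abs_inverse power_int_inverse)
qed

text \<open>As metric balls the translates are closed, hence Borel, and membership in them becomes a
  distance bound.\<close>

lemma translate_padic_ball:
  "(\<lambda>x. a + x) ` padic_ball n = cball (a :: 'p::prime_card padic) (real CARD('p) powi n)"
proof -
  have "y \<in> (\<lambda>x. a + x) ` padic_ball n \<longleftrightarrow> y - a \<in> padic_ball n" for y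
    by (auto simp: image_iff intro!: bexI[of _ "y - a"])
  then show ?thesis
    by (subst set_eq_iff) (simp add: padic_ball_def dist_padic_def padic_abs_diff_commute)
qed

lemma padic_ball_eq_cball: "padic_ball n = cball (0 :: 'p::prime_card padic) (real CARD('p) powi n)"
  using translate_padic_ball[of 0 n] by simp

text \<open>Division by \<open>w\<close> rescales to the unit ball, where every point has exactly
  one residue among the numbers below \<open>p\<close>. Measured with translation invariance, the
  splitting yields a recursion for the measures of balls.\<close>

lemma padic_ball_Suc:
  fixes w :: "'p::prime_card padic"
  assumes w: "padic_abs w = real CARD('p) powi (n + 1)"
  shows "padic_ball (n + 1) = (\<Union>k<CARD('p). (\<lambda>x. w * of_nat k + x) ` padic_ball n)"
    and "disjoint_family_on (\<lambda>k. (\<lambda>x. w * of_nat k + x) ` padic_ball n) {..<CARD('p)}"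
proof -
  let ?q = "real CARD('p)"
  note q1 = P.p_gt_1[where 'p='p]
  have "?q powi (n + 1) > 0" using q1 by simp
  then have w0: "w \<noteq> 0" unfolding w[symmetric] by (rule contrapos_pn) simp
  have lt: "?q powi n < ?q powi (n + 1)" using q1 by (intro power_int_strict_increasing) auto
  have aw: "padic_abs (w * x) = ?q powi (n + 1) * padic_abs x" for x
    by (simp add: padic_abs_mult w)
  show "padic_ball (n + 1) = (\<Union>k<CARD('p). (\<lambda>x. w * of_nat k + x) ` padic_ball n)"
  proof (intro equalityI subsetI)
    fix x :: "'p padic" assume x: "x \<in> padic_ball (n + 1)"
    then have "padic_abs x \<le> padic_abs w" unfolding w by (simp add: padic_ball_def)
    moreover have "padic_abs (x / w) = padic_abs x / padic_abs w"
      by (simp only: divide_inverse padic_abs_mult padic_abs_inverse)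
    ultimately have "padic_abs (x / w) \<le> 1"
      using padic_abs_nonneg[of w] by (auto simp: divide_le_eq_1 less_le)
    then obtain k where k: "k < CARD('p)" "padic_abs (x / w - of_nat k) < 1" by (rule padic_residue)
    have "x - w * of_nat k = w * (x / w - of_nat k)" using w0 by (simp add: field_simps)
    then have "padic_abs (x - w * of_nat k) < ?q powi (n + 1)"
      using k(2) q1 by (simp add: aw)
    \<comment> \<open>The residue only gives a strict bound at the larger radius; discreteness turns
      it into the closed bound at the smaller one.\<close>
    then have "padic_abs (x - w * of_nat k) \<le> ?q powi n" by (rule padic_abs_less_imp_le)
    then show "x \<in> (\<Union>k<CARD('p). (\<lambda>x. w * of_nat k + x) ` padic_ball n)"
      using k(1) by (auto simp: translate_padic_ball dist_padic_def padic_abs_diff_commute)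
  next
    fix x assume "x \<in> (\<Union>k<CARD('p). (\<lambda>x. w * of_nat k + x) ` padic_ball n)"
    then obtain k y where kk: "k < CARD('p)" and y: "padic_abs y \<le> ?q powi n"
      and x: "x = w * of_nat k + y" by (auto simp: padic_ball_def)
    have "padic_abs (of_nat k :: 'p padic) \<le> 1"
      using kk padic_abs_of_nat_diff[of k 0, where 'p='p] by (cases "k = 0") (auto simp: padic_abs_eq_0_iff)
    then have "padic_abs (w * of_nat k) \<le> ?q powi (n + 1)"
      using q1 by (simp add: aw mult_left_le)
    then show "x \<in> padic_ball (n + 1)"
      using padic_abs_add[of "w * of_nat k" y] y lt by (simp add: padic_ball_def x)
  qed
  show "disjoint_family_on (\<lambda>k. (\<lambda>x. w * of_nat k + x) ` padic_ball n) {..<CARD('p)}"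
    unfolding disjoint_family_on_def
  proof (intro ballI impI equals0I)
    fix j k x assume jk: "j \<in> {..<CARD('p)}" "k \<in> {..<CARD('p)}" "j \<noteq> k"
      and "x \<in> (\<lambda>x. w * of_nat j + x) ` padic_ball n \<inter> (\<lambda>x. w * of_nat k + x) ` padic_ball n"
    then obtain y z where yz: "padic_abs y \<le> ?q powi n" "padic_abs z \<le> ?q powi n"
      "w * of_nat j + y = w * of_nat k + z" by (auto simp: padic_ball_def)
    \<comment> \<open>A common point of two translates would make the difference of two elements of
      the small ball as large as \<open>w\<close>.\<close>
    then have "w * (of_nat j - of_nat k) = z - y" by (simp add: algebra_simps)
    then have "?q powi (n + 1) = padic_abs (z - y)"
      using aw[of "of_nat j - of_nat k"] padic_abs_of_nat_diff[of j k, where 'p='p] jk by simp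
    also have "\<dots> \<le> ?q powi n" using padic_abs_diff[of z y] yz by simp
    finally show False using lt by simp
  qed
qed

section \<open>Auxiliary inequalities and series\<close>

lemma young_le_add_powr:
  fixes t s r :: real
  assumes "0 \<le> t" "0 < s" "1 < r"
  shows "t \<le> s + t powr r * s powr (1 - r)"
proof (cases "t \<le> s")
  \<comment> \<open>For \<open>t > s\<close>, split \<open>t\<close> into powers with exponents
    \<open>r\<close> and \<open>1 - r\<close>; the latter is negative, so replacing \<open>t\<close>
    by \<open>s\<close> in that factor increases it.\<close>
  case False
  then have "t = t powr r * t powr (1 - r)" using assms by (simp flip: powr_add)
  also have "\<dots> \<le> t powr r * s powr (1 - r)"
    using assms False by (intro mult_left_mono powr_mono2') auto
  finally show ?thesis using assms by simp
next
  case True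
  then show ?thesis using assms by (simp add: add_increasing2)
qed

lemma continuous_on_padic_abs [continuous_intros]:
  "continuous_on A (padic_abs :: 'p::prime_card padic \<Rightarrow> real)"
  unfolding padic_abs_eq_dist[abs_def] by (intro continuous_intros)

lemma borel_measurable_padic_abs [measurable]:
  "(padic_abs :: 'p::prime_card padic \<Rightarrow> real) \<in> borel_measurable borel"
  by (intro borel_measurable_continuous_onI continuous_intros)

lemma padic_ball_borel [measurable]: "padic_ball n \<in> sets (borel :: 'p::prime_card padic measure)"
  by (simp add: padic_ball_eq_cball)

text \<open>Each \<open>m\<close> is \<open>i + k\<close> or \<open>i - k\<close> with
  \<open>k\<close> its distance to \<open>i\<close>, so two copies of the geometric series dominate.
  The centre is counted twice, hence only an upper bound; it is uniform in \<open>i\<close>.\<close>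

lemma nn_integral_geometric_int:
  fixes t :: real
  assumes "0 \<le> t" "t < 1"
  shows "(\<integral>\<^sup>+m. ennreal (t ^ nat \<bar>m - i\<bar>) \<partial>count_space (UNIV :: int set)) \<le> ennreal (2 / (1 - t))"
proof -
  have "(\<integral>\<^sup>+m. ennreal (t ^ nat \<bar>m - i\<bar>) \<partial>count_space UNIV)
      \<le> (\<integral>\<^sup>+m. (\<Sum>k. ennreal (t ^ k) * (indicator {i + int k} m + indicator {i - int k} m)) \<partial>count_space UNIV)"
  proof (rule nn_integral_mono)
    fix m :: int
    let ?k = "nat \<bar>m - i\<bar>" and ?g = "\<lambda>k. ennreal (t ^ k) * (indicator {i + int k} m + indicator {i - int k} m)"
    have "m = i + int ?k \<or> m = i - int ?k" by auto
    then have "1 \<le> (indicator {i + int ?k} m + indicator {i - int ?k} m :: ennreal)"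
      by (elim disjE) (simp_all add: indicator_def)
    then have "ennreal (t ^ ?k) * 1 \<le> ?g ?k" by (rule mult_left_mono) simp
    also have "?g ?k \<le> (\<Sum>k. ?g k)" using sum_le_suminf[of ?g "{?k}"] by simp
    finally show "ennreal (t ^ ?k) \<le> (\<Sum>k. ?g k)" by simp
  qed
  also have "\<dots> = (\<Sum>k. ennreal (t ^ k) * 2)"
    by (subst nn_integral_suminf)
      (simp_all add: nn_integral_cmult nn_integral_add)
  also have "\<dots> = (\<Sum>k. ennreal (2 * t ^ k))"
    using assms by (simp add: ennreal_mult mult.commute)
  also have "\<dots> = ennreal (2 * (1 / (1 - t)))"
    using assms by (intro suminf_ennreal_eq sums_mult geometric_sums) auto
  finally show ?thesis by simp
qed

text \<open>Spheres are indexed by integers, decompositions by naturals. Written against counting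
  measure, the integer sum can be exchanged with a series by
  \<open>nn_integral_suminf\<close>.\<close>

lemma suminf_int_decode:
  "(\<Sum>k. f (int_decode k)) = (\<integral>\<^sup>+j. f j \<partial>count_space UNIV)" for f :: "int \<Rightarrow> ennreal"
  using nn_integral_bij_count_space[OF bij_int_decode, of f]
  by (simp add: nn_integral_count_space_nat)

text \<open>The sum may converge only conditionally: in that case the right side is infinite and the
  bound is trivial.\<close>

lemma ennreal_norm_sums_le:
  fixes g :: "nat \<Rightarrow> 'a::banach"
  assumes "g sums s"
  shows "ennreal (norm s) \<le> (\<Sum>k. ennreal (norm (g k)))"
proof (cases "(\<Sum>k. ennreal (norm (g k))) = top")
  case False
  then have "summable (\<lambda>k. norm (g k))" by (intro summable_suminf_not_top) auto
  then have "norm s \<le> (\<Sum>k. norm (g k))" and "(\<Sum>k. ennreal (norm (g k))) = ennreal (\<Sum>k. norm (g k))"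
    using summable_norm[of g] assms by (auto simp: sums_iff intro: suminf_ennreal2)
  then show ?thesis by (simp add: ennreal_leI)
qed simp

section \<open>Blocks under Haar measure\<close>

context
  fixes M :: "'p::prime_card padic measure"
  assumes haar: "is_haar M"
begin

section \<open>Haar measure of balls and integrals of the kernel\<close>

lemma haar_sets [measurable_cong, simp]: "sets M = sets borel"
  using haar by (simp add: is_haar_def)

lemma haar_space [simp]: "space M = UNIV"
  using sets_eq_imp_space_eq[OF haar_sets] by simp

lemma emeasure_padic_ball_Suc:
  "emeasure M (padic_ball (n + 1)) = of_nat CARD('p) * emeasure M (padic_ball n)"
proof -
  obtain w :: "'p padic" where w: "padic_abs w = real CARD('p) powi (n + 1)"
    using ex_padic_abs_eq by blast
  have "emeasure M (padic_ball (n + 1)) = (\<Sum>k<CARD('p). emeasure M ((\<lambda>x. w * of_nat k + x) ` padic_ball n))"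
    unfolding padic_ball_Suc(1)[OF w] using padic_ball_Suc(2)[OF w]
    by (intro sum_emeasure[symmetric]) (auto simp: translate_padic_ball)
  also have "\<dots> = (\<Sum>k<CARD('p). emeasure M (padic_ball n))"
    using haar unfolding is_haar_def by (intro sum.cong) (auto simp: padic_ball_eq_cball)
  finally show ?thesis by simp
qed

text \<open>The normalization fixes radius 1; the recursion multiplies by \<open>p\<close> going up,
  and going down the finite nonzero factor \<open>p\<close> is cancelled.\<close>

lemma emeasure_padic_ball: "emeasure M (padic_ball n) = ennreal (real CARD('p) powi n)"
proof (induction n rule: int_induct[where k=0])
  case base
  then show ?case using haar by (simp add: is_haar_def padic_ball_def)
next
  case (step1 i)
  then show ?case unfolding emeasure_padic_ball_Suc using P.p_gt_1[where 'p='p]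
    by (simp add: power_int_add ennreal_mult ennreal_of_nat_eq_real_of_nat mult.commute)
next
  case (step2 i)
  have "real CARD('p) powi i = real CARD('p) * real CARD('p) powi (i - 1)"
    using P.p_gt_1[where 'p='p] by (simp add: power_int_diff)
  then have "of_nat CARD('p) * ennreal (real CARD('p) powi (i - 1)) = of_nat CARD('p) * emeasure M (padic_ball (i - 1))"
    using step2 emeasure_padic_ball_Suc[of "i - 1"]
    by (simp add: ennreal_of_nat_eq_real_of_nat flip: ennreal_mult)
  then show ?case
    using P.p_gt_1[where 'p='p] by (subst (asm) ennreal_mult_cancel_left) (auto simp: ennreal_of_nat_eq_real_of_nat)
qed

lemma measure_padic_ball: "measure M (padic_ball n) = real CARD('p) powi n"
  using P.p_gt_1[where 'p='p] by (simp add: measure_def emeasure_padic_ball)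

text \<open>The kernel power is dominated by a series of constants on the balls of radius
  \<open>X * q ^ m\<close>. As \<open>X\<close> is a power of \<open>p\<close>, these radii are also
  the exact measures, and the integrated terms form a geometric series with ratio
  \<open>q powr (- \<beta>)\<close>.\<close>

lemma nn_integral_kernel_le:
  assumes \<beta>: "0 < \<beta>" and X: "X = real CARD('p) powi j"
  shows "(\<integral>\<^sup>+y. ennreal ((X + padic_abs y) powr (-1 - \<beta>)) \<partial>M)
           \<le> ennreal (X powr (- \<beta>) / (1 - real CARD('p) powr (- \<beta>)))"
proof -
  define q where "q = real CARD('p)"
  have q: "q > 1" unfolding q_def by (rule P.p_gt_1)
  have Xq: "X = q powi j" by (simp add: X q_def)
  then have X0: "X > 0" using q by simp
  define c where "c m = (X * q ^ m) powr (-1 - \<beta>)" for m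
  define B where "B m = (padic_ball (j + int m) :: 'p padic set)" for m
  have Xm: "X * q ^ m = q powi (j + int m)" for m using q by (simp add: Xq power_int_add)
  \<comment> \<open>The term with \<open>X * q ^ m = max X (padic_abs y)\<close> already dominates.\<close>
  have le: "ennreal ((X + padic_abs y) powr (-1 - \<beta>)) \<le> (\<Sum>m. ennreal (c m) * indicator (B m) y)" for y
  proof -
    have "\<exists>m. y \<in> B m \<and> X * q ^ m \<le> X + padic_abs y"
    proof (cases "padic_abs y \<le> X")
      case True
      then show ?thesis using X padic_abs_nonneg[of y] by (intro exI[of _ 0]) (simp add: B_def padic_ball_def)
    next
      case False
      then have "y \<noteq> 0" using X0 by auto
      then obtain i where i: "padic_abs y = q powi i" unfolding q_def by (rule padic_abs_powi)
      have "j < i"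
      proof (rule ccontr)
        assume "\<not> j < i"
        then have "q powi i \<le> q powi j" using q by (intro power_int_increasing) auto
        then show False using False by (simp add: i Xq)
      qed
      then have "X * q ^ nat (i - j) = padic_abs y" by (simp add: Xm i)
      moreover have "y \<in> B (nat (i - j))" using \<open>j < i\<close> i by (simp add: B_def padic_ball_def q_def)
      ultimately show ?thesis using X0 by (intro exI[of _ "nat (i - j)"]) simp
    qed
    then obtain m where m: "y \<in> B m" "X * q ^ m \<le> X + padic_abs y" by blast
    have "(X + padic_abs y) powr (-1 - \<beta>) \<le> c m"
      unfolding c_def using m X0 q \<beta> by (intro powr_mono2') auto
    then have "ennreal ((X + padic_abs y) powr (-1 - \<beta>)) \<le> (\<Sum>m\<in>{m}. ennreal (c m) * indicator (B m) y)"
      using m by (simp add: ennreal_leI)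
    also have "\<dots> \<le> (\<Sum>m. ennreal (c m) * indicator (B m) y)"
      by (rule sum_le_suminf) auto
    finally show ?thesis .
  qed
  have [measurable]: "B m \<in> sets borel" for m by (simp add: B_def)
  have eB: "emeasure M (B m) = ennreal (X * q ^ m)" for m
    using emeasure_padic_ball[of "j + int m"] unfolding Xm by (simp only: B_def q_def)
  have g: "c m * (X * q ^ m) = X powr (- \<beta>) * (q powr (- \<beta>)) ^ m" for m
  proof -
    have "c m * (X * q ^ m) = (X * q ^ m) powr (-1 - \<beta> + 1)"
      unfolding powr_add c_def using X0 q by simp
    also have "\<dots> = X powr (- \<beta>) * (q powr (- \<beta>)) ^ m"
      using X0 q by (simp add: powr_mult powr_power powr_powr flip: powr_realpow) (simp add: mult.commute)
    finally show ?thesis .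
  qed
  have "(\<integral>\<^sup>+y. ennreal ((X + padic_abs y) powr (-1 - \<beta>)) \<partial>M) \<le> (\<integral>\<^sup>+y. (\<Sum>m. ennreal (c m) * indicator (B m) y) \<partial>M)"
    by (intro nn_integral_mono le)
  also have "\<dots> = (\<Sum>m. ennreal (c m) * emeasure M (B m))"
    by (subst nn_integral_suminf) (simp_all add: nn_integral_cmult_indicator)
  also have "\<dots> = (\<Sum>m. ennreal (X powr (- \<beta>) * (q powr (- \<beta>)) ^ m))"
    unfolding eB g[symmetric] using X0 q by (subst ennreal_mult) (auto simp: c_def)
  also have "\<dots> = ennreal (X powr (- \<beta>) * (1 / (1 - q powr (- \<beta>))))"
  proof (rule suminf_ennreal_eq)
    have "norm (q powr (- \<beta>)) < 1" using q \<beta> by (simp add: powr_less_one)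
    then show "(\<lambda>m. X powr (- \<beta>) * (q powr (- \<beta>)) ^ m) sums (X powr (- \<beta>) * (1 / (1 - q powr (- \<beta>))))"
      by (intro sums_mult geometric_sums)
  qed simp
  finally show ?thesis by (simp add: q_def)
qed

text \<open>This replaces Hoelder's inequality: for \<open>s\<close> close to the optimal weight, Young's inequality
  loses only a constant.\<close>

lemma nn_integral_mult_kernel_le:
  fixes a :: "'p padic \<Rightarrow> complex" and s K :: "'p padic \<Rightarrow> real"
  assumes a: "set_borel_measurable M (- {0}) a" and supp: "{y. y \<noteq> 0 \<and> a y \<noteq> 0} \<subseteq> E"
    and [measurable]: "E \<in> sets borel" "s \<in> borel_measurable borel" "K \<in> borel_measurable borel"
    and s: "\<And>y. 0 < s y" and K: "\<And>y. 0 \<le> K y" and v: "\<And>y. y \<in> E \<Longrightarrow> K y * s y powr (1 - r) \<le> v" "0 \<le> v"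
    and r: "1 < r"
    and A: "(\<integral>\<^sup>+y. ennreal (indicator (- {0}) y * norm (a y) powr r) \<partial>M) \<le> ennreal A" "0 \<le> A"
  shows "(\<integral>\<^sup>+y. ennreal (indicator (- {0}) y * (norm (a y) * K y)) \<partial>M)
     \<le> (\<integral>\<^sup>+y. ennreal (K y * s y) * indicator E y \<partial>M) + ennreal (v * A)"
proof -
  \<comment> \<open>Masking at 0 is needed for measurability, which \<open>a\<close> is only known
    to have away from 0.\<close>
  define g where "g y = indicator (- {0}) y *\<^sub>R a y" for y
  have [measurable]: "g \<in> borel_measurable M" using a by (simp add: g_def[abs_def] set_borel_measurable_def)
  have g: "indicator (- {0}) y * norm (a y) powr r = norm (g y) powr r" for y
    by (simp add: g_def indicator_def)
  have "(\<integral>\<^sup>+y. ennreal (indicator (- {0}) y * (norm (a y) * K y)) \<partial>M)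
     \<le> (\<integral>\<^sup>+y. (ennreal (K y * s y) * indicator E y + ennreal v * ennreal (norm (g y) powr r)) \<partial>M)"
  proof (rule nn_integral_mono)
    fix y
    show "ennreal (indicator (- {0}) y * (norm (a y) * K y))
      \<le> ennreal (K y * s y) * indicator E y + ennreal v * ennreal (norm (g y) powr r)"
    proof (cases "y \<noteq> 0 \<and> a y \<noteq> 0")
      case True
      then have yE: "y \<in> E" using supp by auto
      \<comment> \<open>Young's inequality at the weight \<open>s y\<close>, multiplied by the
        kernel; on \<open>E\<close> the coefficient of the \<open>r\<close>-th power is then at most
        \<open>v\<close>.\<close>
      have "norm (a y) * K y \<le> (s y + norm (a y) powr r * s y powr (1 - r)) * K y"
        using s K r by (intro mult_right_mono young_le_add_powr) auto
      also have "\<dots> = K y * s y + (K y * s y powr (1 - r)) * norm (a y) powr r"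
        by (simp add: algebra_simps)
      also have "\<dots> \<le> K y * s y + v * norm (a y) powr r"
        using v(1)[OF yE] by (intro add_left_mono mult_right_mono) auto
      finally have "ennreal (norm (a y) * K y) \<le> ennreal (K y * s y + v * norm (a y) powr r)" by (rule ennreal_leI)
      also have "\<dots> = ennreal (K y * s y) + ennreal v * ennreal (norm (a y) powr r)"
        using K[of y] less_imp_le[OF s[of y]] v(2) by (simp add: ennreal_mult)
      finally show ?thesis using True yE by (simp add: g_def)
    qed auto
  qed
  also have "\<dots> = (\<integral>\<^sup>+y. ennreal (K y * s y) * indicator E y \<partial>M) + ennreal v * (\<integral>\<^sup>+y. ennreal (norm (g y) powr r) \<partial>M)"
    by (subst nn_integral_add) (auto simp: nn_integral_cmult)
  also have "\<dots> \<le> (\<integral>\<^sup>+y. ennreal (K y * s y) * indicator E y \<partial>M) + ennreal v * ennreal A"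
    using A(1) unfolding g by (intro add_left_mono mult_left_mono) auto
  finally show ?thesis using v(2) A(2) by (simp add: ennreal_mult)
qed

section \<open>The transform of a single block\<close>

lemma central_block_nn_integral:
  assumes "in_Lr M r a" "Lr_norm M r a \<le> A" "0 < r"
  shows "(\<integral>\<^sup>+y. ennreal (indicator (- {0}) y * norm (a y) powr r) \<partial>M) \<le> ennreal (A powr r)"
proof -
  let ?I = "LINT y:- {0}|M. norm (a y) powr r"
  have I: "0 \<le> ?I" unfolding set_lebesgue_integral_def by (intro integral_nonneg_AE) auto
  have "(\<integral>\<^sup>+y. ennreal (indicator (- {0}) y * norm (a y) powr r) \<partial>M) = ennreal ?I"
    using assms(1) unfolding in_Lr_def set_integrable_def set_lebesgue_integral_def
    by (subst nn_integral_eq_integral) auto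
  also have "?I = (?I powr (1 / r)) powr r" using I assms(3) by (simp add: powr_powr)
  also have "\<dots> \<le> A powr r" using assms(2,3) unfolding Lr_norm_def by (intro powr_mono2) auto
  finally show ?thesis by (simp add: ennreal_leI)
qed

lemma borel_measurable_padic_abs_haar [measurable]: "padic_abs \<in> borel_measurable M"
  using borel_measurable_padic_abs by (simp cong: measurable_cong_sets)

text \<open>With \<open>X\<close>, \<open>Y\<close> the radii of the sphere and the ball and
  \<open>\<beta> = 1 / r\<close>, the weighted Young inequality gives a multiple of
  \<open>X powr (- \<beta>) * Y powr (- \<alpha>)\<close> if \<open>X \<le> Y\<close>, and of
  \<open>Y powr (1 - \<alpha> - \<beta>) / X\<close> otherwise. Relative to
  \<open>X powr (- (\<beta> + \<alpha>))\<close> these gain the powers \<open>\<alpha>\<close> and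
  \<open>1 - \<alpha> - \<beta>\<close> of the ratio of the smaller to the larger radius, both at
  least \<open>\<delta>\<close>.\<close>

lemma central_block_hilbert_le:
  fixes a :: "'p padic \<Rightarrow> complex" and r \<alpha> \<delta> :: real
  defines "q \<equiv> real CARD('p)"
  assumes a: "in_Lr M r a" "{y. y \<noteq> 0 \<and> a y \<noteq> 0} \<subseteq> padic_ball n"
      "Lr_norm M r a \<le> measure M (padic_ball n :: 'p padic set) powr (- \<alpha>)"
    and r: "1 < r" and \<delta>: "\<delta> \<le> \<alpha>" "\<delta> \<le> 1 - 1 / r - \<alpha>"
  shows "(\<integral>\<^sup>+y. ennreal (indicator (- {0}) y * (norm (a y) / (q powi j + padic_abs y))) \<partial>M)
    \<le> ennreal ((1 + 1 / (1 - q powr (- (1 / r)))) * (q powi j) powr (- (1 / r + \<alpha>)) * (q powr (- \<delta>)) ^ nat \<bar>j - n\<bar>)"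
proof -
  define \<beta> where "\<beta> = 1 / r"
  have \<beta>: "0 < \<beta>" "r * \<beta> = 1" using r by (auto simp: \<beta>_def)
  have q: "q > 1" unfolding q_def by (rule P.p_gt_1)
  define X where "X = q powi j"
  define Y where "Y = q powi n"
  have pos: "X > 0" "Y > 0" using q by (auto simp: X_def Y_def)
  \<comment> \<open>For \<open>X \<le> Y\<close> the 1 pays for the \<open>r\<close>-th power term
    and the quotient for the kernel integral. For \<open>X > Y\<close> both terms agree, and
    \<open>D \<ge> 2\<close> absorbs them.\<close>
  define D where "D = 1 + 1 / (1 - q powr (- \<beta>))"
  have qb: "0 < q powr (- \<beta>)" "q powr (- \<beta>) < 1" using q \<beta> by (auto simp: powr_less_one)
  then have D: "2 \<le> D" by (simp add: D_def)
  have a1: "set_borel_measurable M (- {0}) a" using a(1) by (simp add: in_Lr_def)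
  have aI: "(\<integral>\<^sup>+y. ennreal (indicator (- {0}) y * norm (a y) powr r) \<partial>M) \<le> ennreal ((Y powr (- \<alpha>)) powr r)"
    using central_block_nn_integral[OF a(1,3)] r by (simp add: measure_padic_ball Y_def q_def)
  let ?K = "\<lambda>y :: 'p padic. inverse (X + padic_abs y)"
  have Kp: "0 < X + padic_abs y" for y :: "'p padic" using pos padic_abs_nonneg[of y] by linarith
  have lnX: "ln X = j * ln q" "ln Y = n * ln q" using q by (simp_all add: X_def Y_def flip: powr_real_of_int')
  \<comment> \<open>In logarithmic form the final comparisons become linear inequalities between
    exponents.\<close>
  have t: "(q powr (- \<delta>)) ^ nat \<bar>j - n\<bar> = exp (- \<delta> * \<bar>ln X - ln Y\<bar>)"
  proof -
    have "\<bar>ln X - ln Y\<bar> = \<bar>real_of_int j - n\<bar> * ln q"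
      using q unfolding lnX by (simp add: abs_mult flip: left_diff_distrib)
    then show ?thesis using q by (simp add: powr_def of_nat_nat exp_of_nat_mult[symmetric] mult_ac)
  qed
  have main: "(\<integral>\<^sup>+y. ennreal (indicator (- {0}) y * (norm (a y) * ?K y)) \<partial>M)
     \<le> ennreal (D * X powr (- (\<beta> + \<alpha>)) * exp (- \<delta> * \<bar>ln X - ln Y\<bar>))"
  proof (cases "X \<le> Y")
    case True
    \<comment> \<open>The factor with exponent \<open>- \<beta>\<close> makes the kernel times the
      weight integrable over the whole field, while \<open>r * \<beta> = 1\<close> leaves the same
      exponent in \<open>?v\<close>. Both terms thus scale alike.\<close>
    let ?s = "\<lambda>y :: 'p padic. Y powr (- \<alpha>) * (X + padic_abs y) powr (- \<beta>)"
    let ?v = "Y powr (- \<alpha> * (1 - r)) * X powr (- \<beta>)"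
    have "(\<integral>\<^sup>+y. ennreal (indicator (- {0}) y * (norm (a y) * ?K y)) \<partial>M)
      \<le> (\<integral>\<^sup>+y. ennreal (?K y * ?s y) * indicator (padic_ball n) y \<partial>M) + ennreal (?v * (Y powr (- \<alpha>)) powr r)"
    proof (rule nn_integral_mult_kernel_le[OF a1 a(2) _ _ _ _ _ _ _ r aI])
      fix y :: "'p padic"
      have "?K y * ?s y powr (1 - r) = Y powr (- \<alpha> * (1 - r)) * ((X + padic_abs y) powr (-1) * (X + padic_abs y) powr (- \<beta> * (1 - r)))"
        using Kp[of y] pos powr_minus[of "X + padic_abs y" 1] by (simp add: powr_mult powr_powr)
      also have "\<dots> = Y powr (- \<alpha> * (1 - r)) * (X + padic_abs y) powr (- \<beta>)"
      proof -
        have "-1 + - \<beta> * (1 - r) = - \<beta>" using \<beta>(2) by (simp add: algebra_simps)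
        then show ?thesis by (metis powr_add)
      qed
      also have "\<dots> \<le> ?v"
        using pos \<beta> padic_abs_nonneg[of y] by (intro mult_left_mono powr_mono2') auto
      finally show "?K y * ?s y powr (1 - r) \<le> ?v" .
      show "0 < ?s y" using Kp[of y] pos by simp
      show "0 \<le> ?K y" using Kp[of y] by simp
    qed (use pos in simp_all)
    also have "(\<integral>\<^sup>+y. ennreal (?K y * ?s y) * indicator (padic_ball n) y \<partial>M)
        \<le> (\<integral>\<^sup>+y. ennreal (Y powr (- \<alpha>)) * ennreal ((X + padic_abs y) powr (-1 - \<beta>)) \<partial>M)"
    proof (rule nn_integral_mono)
      fix y :: "'p padic"
      have K: "?K y * ?s y = Y powr (- \<alpha>) * (X + padic_abs y) powr (-1 - \<beta>)"
        using Kp[of y] by (simp add: powr_diff powr_minus divide_inverse powr_add)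
      then show "ennreal (?K y * ?s y) * indicator (padic_ball n) y
        \<le> ennreal (Y powr (- \<alpha>)) * ennreal ((X + padic_abs y) powr (-1 - \<beta>))"
        unfolding K by (simp add: ennreal_mult indicator_def)
    qed
    also have "\<dots> = ennreal (Y powr (- \<alpha>)) * (\<integral>\<^sup>+y. ennreal ((X + padic_abs y) powr (-1 - \<beta>)) \<partial>M)"
      by (rule nn_integral_cmult) simp
    also have "\<dots> \<le> ennreal (Y powr (- \<alpha>)) * ennreal (X powr (- \<beta>) / (1 - q powr (- \<beta>)))"
      unfolding q_def using \<beta> by (intro mult_left_mono nn_integral_kernel_le) (auto simp: X_def q_def)
    also have "\<dots> + ennreal (?v * (Y powr (- \<alpha>)) powr r) = ennreal (D * X powr (- \<beta>) * Y powr (- \<alpha>))"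
    proof -
      have "?v * (Y powr (- \<alpha>)) powr r = X powr (- \<beta>) * Y powr (- \<alpha>)"
        by (simp add: powr_powr mult_ac flip: powr_add) (simp add: algebra_simps)
      then show ?thesis using qb by (simp add: D_def algebra_simps flip: ennreal_mult ennreal_plus)
    qed
    also have "\<dots> \<le> ennreal (D * X powr (- (\<beta> + \<alpha>)) * exp (- \<delta> * \<bar>ln X - ln Y\<bar>))"
    proof (rule ennreal_leI)
      have "ln X \<le> ln Y" using True pos by simp
      then have "- \<alpha> * (ln Y - ln X) \<le> - \<delta> * (ln Y - ln X)" using \<delta> by (intro mult_right_mono) auto
      then have "- \<beta> * ln X + - \<alpha> * ln Y \<le> - (\<beta> + \<alpha>) * ln X + - \<delta> * \<bar>ln X - ln Y\<bar>"
        using \<open>ln X \<le> ln Y\<close> by (simp add: algebra_simps)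
      then have "X powr (- \<beta>) * Y powr (- \<alpha>) \<le> X powr (- (\<beta> + \<alpha>)) * exp (- \<delta> * \<bar>ln X - ln Y\<bar>)"
        using pos by (simp add: powr_def flip: exp_add)
      then show "D * X powr (- \<beta>) * Y powr (- \<alpha>) \<le> D * X powr (- (\<beta> + \<alpha>)) * exp (- \<delta> * \<bar>ln X - ln Y\<bar>)"
        using D by (simp add: mult.assoc)
    qed
    finally show ?thesis by (simp add: add_right_mono)
  next
    case False
    \<comment> \<open>Here the kernel is comparable to \<open>inverse X\<close> on the whole ball,
      so a constant weight suffices: the height of a function of constant modulus on the ball with
      norm \<open>Y powr (- \<alpha>)\<close>.\<close>
    let ?s = "\<lambda>y :: 'p padic. Y powr (- (\<alpha> + \<beta>))"
    let ?v = "Y powr (- (\<alpha> + \<beta>) * (1 - r)) * inverse X"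
    have KX: "?K y \<le> inverse X" for y :: "'p padic"
      using pos padic_abs_nonneg[of y] by (intro le_imp_inverse_le) auto
    have "(\<integral>\<^sup>+y. ennreal (indicator (- {0}) y * (norm (a y) * ?K y)) \<partial>M)
      \<le> (\<integral>\<^sup>+y. ennreal (?K y * ?s y) * indicator (padic_ball n) y \<partial>M) + ennreal (?v * (Y powr (- \<alpha>)) powr r)"
    proof (rule nn_integral_mult_kernel_le[OF a1 a(2) _ _ _ _ _ _ _ r aI])
      fix y :: "'p padic"
      show "?K y * ?s y powr (1 - r) \<le> ?v"
        using mult_right_mono[OF KX[of y], of "Y powr (- (\<alpha> + \<beta>) * (1 - r))"]
        by (simp add: powr_powr mult.commute)
      show "0 < ?s y" using Kp[of y] pos by simp
      show "0 \<le> ?K y" using Kp[of y] by simp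
    qed (use pos in simp_all)
    also have "(\<integral>\<^sup>+y. ennreal (?K y * ?s y) * indicator (padic_ball n) y \<partial>M)
        \<le> (\<integral>\<^sup>+y. ennreal (inverse X * Y powr (- (\<alpha> + \<beta>))) * indicator (padic_ball n) (y :: 'p padic) \<partial>M)"
      using KX by (intro nn_integral_mono mult_right_mono ennreal_leI) auto
    also have "\<dots> = ennreal (inverse X * Y powr (1 - \<alpha> - \<beta>))"
    proof -
      have "inverse X * Y powr (- (\<alpha> + \<beta>)) * Y = inverse X * (Y powr (- (\<alpha> + \<beta>)) * Y powr 1)"
        using pos by simp
      also have "\<dots> = inverse X * Y powr (1 - \<alpha> - \<beta>)"
        by (simp only: flip: powr_add) (simp add: algebra_simps)
      finally have "inverse X * Y powr (- (\<alpha> + \<beta>)) * Y = inverse X * Y powr (1 - \<alpha> - \<beta>)" .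
      moreover have "emeasure M (padic_ball n) = ennreal Y"
        by (simp add: emeasure_padic_ball Y_def q_def)
      ultimately show ?thesis
        using pos by (subst nn_integral_cmult_indicator) (simp_all flip: ennreal_mult)
    qed
    also have "\<dots> + ennreal (?v * (Y powr (- \<alpha>)) powr r) = ennreal (2 * inverse X * Y powr (1 - \<alpha> - \<beta>))"
    proof -
      have "- (\<alpha> + \<beta>) * (1 - r) + - \<alpha> * r = 1 - \<alpha> - \<beta>" using \<beta>(2) by (simp add: algebra_simps)
      then have "?v * (Y powr (- \<alpha>)) powr r = inverse X * Y powr (1 - \<alpha> - \<beta>)"
        by (simp add: powr_powr mult_ac flip: powr_add)
      then show ?thesis using pos by (simp flip: ennreal_plus)
    qed
    also have "\<dots> \<le> ennreal (D * X powr (- (\<beta> + \<alpha>)) * exp (- \<delta> * \<bar>ln X - ln Y\<bar>))"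
    proof (rule ennreal_leI)
      have l: "ln Y \<le> ln X" using False pos by simp
      then have "- (1 - \<beta> - \<alpha>) * (ln X - ln Y) \<le> - \<delta> * (ln X - ln Y)"
        using \<delta> by (intro mult_right_mono) (auto simp: \<beta>_def)
      then have "- ln X + (1 - \<alpha> - \<beta>) * ln Y \<le> - (\<beta> + \<alpha>) * ln X + - \<delta> * \<bar>ln X - ln Y\<bar>"
        using l by (simp add: algebra_simps)
      then have "exp (- ln X + (1 - \<alpha> - \<beta>) * ln Y) \<le> exp (- (\<beta> + \<alpha>) * ln X + - \<delta> * \<bar>ln X - ln Y\<bar>)"
        by simp
      moreover have "exp (- ln X + (1 - \<alpha> - \<beta>) * ln Y) = inverse X * Y powr (1 - \<alpha> - \<beta>)"
        unfolding exp_add exp_minus using pos by (simp add: powr_def)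
      moreover have "exp (- (\<beta> + \<alpha>) * ln X + - \<delta> * \<bar>ln X - ln Y\<bar>)
          = X powr (- (\<beta> + \<alpha>)) * exp (- \<delta> * \<bar>ln X - ln Y\<bar>)"
        unfolding exp_add using pos by (simp add: powr_def)
      ultimately have "inverse X * Y powr (1 - \<alpha> - \<beta>) \<le> X powr (- (\<beta> + \<alpha>)) * exp (- \<delta> * \<bar>ln X - ln Y\<bar>)"
        by (simp only:)
      then have "2 * (inverse X * Y powr (1 - \<alpha> - \<beta>)) \<le> D * (X powr (- (\<beta> + \<alpha>)) * exp (- \<delta> * \<bar>ln X - ln Y\<bar>))"
        by (rule mult_mono[OF D]) (use D pos in auto)
      then show "2 * inverse X * Y powr (1 - \<alpha> - \<beta>) \<le> D * X powr (- (\<beta> + \<alpha>)) * exp (- \<delta> * \<bar>ln X - ln Y\<bar>)"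
        by (simp add: mult.assoc)
    qed
    finally show ?thesis by (simp add: add_right_mono)
  qed
  then show ?thesis by (simp add: t D_def \<beta>_def X_def divide_inverse)
qed

section \<open>From bounds on spheres to block decompositions\<close>

text \<open>If \<open>L j = 0\<close>, then \<open>F\<close> vanishes on the sphere by \<open>bound\<close> and the division by zero yields the
  zero block.\<close>

lemma block_decomp_spheres:
  fixes F :: "'p padic \<Rightarrow> complex" and L :: "int \<Rightarrow> real"
  assumes F: "set_borel_measurable M (- {0}) F" and r: "0 < r"
    and bound: "\<And>x j. padic_abs x = real CARD('p) powi j \<Longrightarrow> norm (F x) \<le> L j * padic_abs x powr (- (1 / r + \<alpha>))"
    and L: "\<And>j. 0 \<le> L j" "summable (\<lambda>k. L (int_decode k))"
  shows "block_decomp M r \<alpha> F (\<lambda>k. of_real (L (int_decode k)))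
     (\<lambda>k x. of_bool (padic_abs x = real CARD('p) powi int_decode k) * F x / of_real (L (int_decode k)))"
  unfolding block_decomp_def
proof (intro conjI allI)
  let ?q = "real CARD('p)"
  note q = P.p_gt_1[where 'p='p]
  show "summable (\<lambda>k. norm (of_real (L (int_decode k)) :: complex))" using L by simp
  show "AE x in M. x \<noteq> 0 \<longrightarrow> (\<lambda>k. of_real (L (int_decode k)) *
      (of_bool (padic_abs x = ?q powi int_decode k) * F x / of_real (L (int_decode k)))) sums F x"
  proof (intro AE_I2 impI)
    fix x :: "'p padic" assume "x \<noteq> 0"
    then obtain j where j: "padic_abs x = ?q powi j" by (rule padic_abs_powi)
    have "F x = 0" if "L j = 0" using bound[OF j] that by simp
    \<comment> \<open>Distinct exponents give distinct radii, so at a given point only the index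
      \<open>int_encode j\<close> contributes.\<close>
    moreover have "?q powi j = ?q powi i \<longleftrightarrow> i = j" for i
      using power_int_strict_increasing[of i j ?q] power_int_strict_increasing[of j i ?q] q
      by (metis less_irrefl linorder_neqE_linordered_idom)
    ultimately have "(\<lambda>k. of_real (L (int_decode k)) *
      (of_bool (padic_abs x = ?q powi int_decode k) * F x / of_real (L (int_decode k))))
      = (\<lambda>k. if k = int_encode j then F x else 0)"
      unfolding j by (auto simp: fun_eq_iff)
    then show "(\<lambda>k. of_real (L (int_decode k)) *
      (of_bool (padic_abs x = ?q powi int_decode k) * F x / of_real (L (int_decode k)))) sums F x"
      using sums_single[of "int_encode j" "\<lambda>_. F x"] by simp
  qed
  fix k
  define j where "j = int_decode k"
  define b where "b x = of_bool (padic_abs x = ?q powi j) * F x / of_real (L j)" for x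
  define X where "X = ?q powi j"
  have X: "0 < X" using q by (simp add: X_def)
  define A where "A = X powr (- (1 / r + \<alpha>))"
  have [measurable]: "(\<lambda>x. indicator (- {0}) x *\<^sub>R F x) \<in> borel_measurable M"
    using F by (simp add: set_borel_measurable_def)
  have "{x. padic_abs x = ?q powi j} \<in> sets (borel :: 'p padic measure)"
    by (intro borel_closed closed_Collect_eq continuous_intros)
  then have [measurable]: "{x :: 'p padic. padic_abs x = ?q powi j} \<in> sets M" by simp
  have "(\<lambda>x. indicator (- {0}) x *\<^sub>R b x) = (\<lambda>x. indicator {x. padic_abs x = ?q powi j} x *\<^sub>R
      (indicator (- {0}) x *\<^sub>R F x) / of_real (L j))"
    by (auto simp: b_def indicator_def)
  also have "\<dots> \<in> borel_measurable M" by measurable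
  finally have bm [measurable]: "(\<lambda>x. indicator (- {0}) x *\<^sub>R b x) \<in> borel_measurable M" .
  have bA: "norm (b x) \<le> A * indicator (padic_ball j) x" for x
  proof (cases "padic_abs x = ?q powi j")
    case True
    then have "norm (F x) \<le> L j * A" using bound[OF True] by (simp add: A_def X_def)
    then have "norm (b x) \<le> A"
      using L(1)[of j] by (cases "L j = 0") (auto simp: b_def True norm_divide field_simps A_def)
    then show ?thesis using True by (simp add: padic_ball_def)
  qed (simp add: b_def A_def)
  have bA': "norm (b x) powr r \<le> A powr r * indicator (padic_ball j) x" for x
    using bA[of x] r by (auto simp: indicator_def intro: powr_mono2 split: if_splits)
  have ball: "emeasure M (padic_ball j) < \<infinity>" by (simp add: emeasure_padic_ball)
  have gi: "integrable M (\<lambda>x. A powr r * indicator (padic_ball j) x)"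
    using ball by simp
  have m: "(\<lambda>x. indicator (- {0}) x *\<^sub>R norm (b x) powr r) \<in> borel_measurable M"
  proof -
    have eq: "(\<lambda>x. indicator (- {0}) x *\<^sub>R norm (b x) powr r) = (\<lambda>x. norm (indicator (- {0}) x *\<^sub>R b x) powr r)"
      by (auto simp: indicator_def)
    show ?thesis unfolding eq by measurable
  qed
  have le: "norm (indicator (- {0}) x *\<^sub>R norm (b x) powr r) \<le> norm (A powr r * indicator (padic_ball j) x)" for x
    using bA'[of x] by (auto simp: indicator_def)
  have i: "integrable M (\<lambda>x. indicator (- {0}) x *\<^sub>R norm (b x) powr r)"
    by (rule Bochner_Integration.integrable_bound[OF gi m]) (intro AE_I2 le)
  have inLr: "in_Lr M r b" using bm i by (simp add: in_Lr_def set_borel_measurable_def set_integrable_def)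
  have supp: "{x. x \<noteq> 0 \<and> b x \<noteq> 0} \<subseteq> padic_ball j" by (auto simp: b_def padic_ball_def)
  have I0: "0 \<le> (LINT x:- {0}|M. norm (b x) powr r)"
    unfolding set_lebesgue_integral_def by (intro integral_nonneg_AE) auto
  have "(LINT x:- {0}|M. norm (b x) powr r) \<le> (LINT x|M. A powr r * indicator (padic_ball j) x)"
    unfolding set_lebesgue_integral_def by (rule integral_mono[OF i gi]) (use le in \<open>auto simp: indicator_def split: if_splits\<close>)
  also have "\<dots> = A powr r * X" using ball by (simp add: measure_padic_ball X_def)
  finally have "Lr_norm M r b \<le> (A powr r * X) powr (1 / r)"
    unfolding Lr_norm_def using r I0 by (intro powr_mono2) auto
  \<comment> \<open>The ball of radius \<open>X\<close> has measure \<open>X\<close>, whose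
    \<open>r\<close>-th root cancels the \<open>1 / r\<close> in the exponent of \<open>A\<close>;
    this leaves exactly the normalization of a block.\<close>
  also have "\<dots> = A * X powr (1 / r)" using r X by (simp add: powr_mult powr_powr A_def)
  also have "\<dots> = X powr (- \<alpha>)" unfolding A_def by (simp flip: powr_add)
  finally have "Lr_norm M r b \<le> measure M (padic_ball j :: 'p padic set) powr (- \<alpha>)"
    by (simp add: measure_padic_ball X_def)
  then have "central_block M r \<alpha> b"
    unfolding central_block_def using inLr supp by blast
  then show "central_block M r \<alpha> (\<lambda>x. of_bool (padic_abs x = ?q powi int_decode k) * F x / of_real (L (int_decode k)))"
    by (simp add: b_def[abs_def] j_def)
qed

text \<open>The transform depends on \<open>x\<close> only through \<open>padic_abs x\<close>, which is locally constant away from \<open>0\<close>.\<close>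

lemma continuous_on_hilbert_op: "continuous_on (- {0}) (hilbert_op M f)"
proof -
  have "isCont (hilbert_op M f) x" if "x \<noteq> 0" for x :: "'p padic"
  proof -
    have "padic_abs x > 0" using that padic_abs_nonneg[of x] padic_abs_eq_0_iff[of x] by linarith
    then have "eventually (\<lambda>y. dist y x < padic_abs x) (nhds x)"
      unfolding eventually_nhds_metric by blast
    then have "eventually (\<lambda>y. hilbert_op M f y = hilbert_op M f x) (nhds x)"
    proof eventually_elim
      case (elim y)
      then have "padic_abs y = padic_abs x"
        by (intro padic_abs_eq_if_close) (simp add: dist_padic_def padic_abs_diff_commute)
      then show ?case by (simp add: hilbert_op_def hilbert_integrand_def[abs_def])
    qed
    then show ?thesis
      using isCont_cong[of "hilbert_op M f" "\<lambda>_. hilbert_op M f x" x] by simp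
  qed
  then show ?thesis by (simp add: continuous_at_imp_continuous_on)
qed

text \<open>On a compact set away from 0 a continuous function is bounded, and the set lies in a
  ball of finite measure.\<close>

lemma in_Lr_loc_continuous_on:
  assumes F: "continuous_on (- {0}) F" and r: "0 \<le> r"
  shows "in_Lr_loc M r F"
proof -
  have [simp]: "borel_measurable M = borel_measurable borel" by (simp cong: measurable_cong_sets)
  have "set_borel_measurable M (- {0}) F"
    unfolding set_borel_measurable_def using borel_measurable_continuous_on_indicator[OF _ F] by simp
  moreover have "set_integrable M K (\<lambda>x. norm (F x) powr r)" if K: "compact K" "K \<subseteq> - {0}" for K
  proof -
    have cF: "continuous_on K F" using F K(2) by (rule continuous_on_subset)
    have Kb: "K \<in> sets borel" using K(1) by (simp add: compact_imp_closed)
    have m: "(\<lambda>x. indicator K x *\<^sub>R norm (F x) powr r) \<in> borel_measurable borel"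
    proof -
      have [measurable]: "(\<lambda>x. indicator K x *\<^sub>R F x) \<in> borel_measurable borel"
        by (rule borel_measurable_continuous_on_indicator[OF Kb cF])
      have eq: "(\<lambda>x. indicator K x *\<^sub>R norm (F x) powr r) = (\<lambda>x. norm (indicator K x *\<^sub>R F x) powr r)"
        by (auto simp: indicator_def)
      show ?thesis unfolding eq by measurable
    qed
    obtain C where C: "\<And>x. x \<in> K \<Longrightarrow> norm (F x) \<le> C"
      using compact_imp_bounded[OF compact_continuous_image[OF cF K(1)]] by (auto simp: bounded_iff)
    obtain e where e: "\<And>x. x \<in> K \<Longrightarrow> dist 0 x \<le> e"
      using compact_imp_bounded[OF K(1)] bounded_any_center[of K 0] by blast
    obtain n where n: "e < real CARD('p) ^ n"
      using real_arch_pow[OF P.p_gt_1[where 'p='p]] by blast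
    have "K \<subseteq> padic_ball (int n)" unfolding padic_ball_eq_cball using e n by fastforce
    then have "emeasure M K \<le> emeasure M (padic_ball (int n))" by (rule emeasure_mono) simp
    also have "\<dots> < \<infinity>" by (simp add: emeasure_padic_ball)
    finally have i: "integrable M (\<lambda>x. C powr r * indicator K x)" using Kb by simp
    have le: "norm (indicator K x *\<^sub>R norm (F x) powr r) \<le> norm (C powr r * indicator K x)" for x
      using C[of x] r by (auto simp: indicator_def intro: powr_mono2)
    show ?thesis unfolding set_integrable_def
      by (rule Bochner_Integration.integrable_bound[OF i]) (use m le in auto)
  qed
  ultimately show ?thesis by (simp add: in_Lr_loc_def)
qed

text \<open>\<open>L\<close> is \<open>D\<close> times the convolution of the
  \<open>norm (l k)\<close> with powers of \<open>t\<close>. Summing over spheres first costs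
  \<open>2 / (1 - t)\<close> whatever the radii of the blocks. Keeping the norm inside the integral
  lets one bound yield both integrability and size.\<close>

lemma block_decomp_nn_integral_hilbert_le:
  fixes r \<alpha> \<delta> :: real and f :: "'p padic \<Rightarrow> complex"
  defines "D \<equiv> 1 + 1 / (1 - real CARD('p) powr (- (1 / r)))" and "t \<equiv> real CARD('p) powr (- \<delta>)"
  assumes dec: "block_decomp M r \<alpha> f l a"
    and r: "1 < r" and \<delta>: "0 < \<delta>" "\<delta> \<le> \<alpha>" "\<delta> \<le> 1 - 1 / r - \<alpha>"
  obtains L :: "int \<Rightarrow> real" where "\<And>j. 0 \<le> L j" "summable (\<lambda>k. L (int_decode k))"
    "(\<Sum>k. L (int_decode k)) \<le> D * (2 / (1 - t)) * (\<Sum>k. norm (l k))"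
    "\<And>x j. padic_abs x = real CARD('p) powi j \<Longrightarrow>
       (\<integral>\<^sup>+y. ennreal (norm (indicator (- {0}) y *\<^sub>R hilbert_integrand f x y)) \<partial>M)
         \<le> ennreal (L j * padic_abs x powr (- (1 / r + \<alpha>)))"
proof -
  define q where "q = real CARD('p)"
  have q: "q > 1" unfolding q_def by (rule P.p_gt_1)
  have t: "0 \<le> t" "t < 1" using q \<delta> by (auto simp: t_def q_def powr_less_one)
  have D: "0 \<le> D" using q r by (simp add: D_def q_def powr_less_one less_imp_le)
  have l: "summable (\<lambda>k. norm (l k))" and blk: "\<And>k. central_block M r \<alpha> (a k)"
    and ae: "AE x in M. x \<noteq> 0 \<longrightarrow> (\<lambda>k. l k * a k x) sums f x"
    using dec by (auto simp: block_decomp_def)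
  obtain n where n: "\<And>k. {x. x \<noteq> 0 \<and> a k x \<noteq> 0} \<subseteq> padic_ball (n k)"
      "\<And>k. Lr_norm M r (a k) \<le> measure M (padic_ball (n k) :: 'p padic set) powr (- \<alpha>)"
  proof -
    have "\<forall>k. \<exists>n. {x. x \<noteq> 0 \<and> a k x \<noteq> 0} \<subseteq> padic_ball n
        \<and> Lr_norm M r (a k) \<le> measure M (padic_ball n :: 'p padic set) powr (- \<alpha>)"
      using blk by (auto simp: central_block_def)
    from choice[OF this] show ?thesis using that by blast
  qed
  have ak: "in_Lr M r (a k)" for k using blk by (simp add: central_block_def)
  \<comment> \<open>Extended nonnegative values allow exchanging the two summations before
    finiteness is known; finiteness of each \<open>S j\<close> then follows from that of the
    total.\<close>
  define S where "S j = (\<Sum>k. ennreal (norm (l k)) * ennreal (t ^ nat \<bar>j - n k\<bar>))" for j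
  define B where "B = (\<Sum>k. norm (l k)) * (2 / (1 - t))"
  have B0: "0 \<le> B" using l t by (simp add: B_def suminf_nonneg)
  have SB: "(\<Sum>k. S (int_decode k)) \<le> ennreal B"
  proof -
    have "(\<Sum>k. S (int_decode k)) = (\<Sum>k. \<integral>\<^sup>+j. ennreal (norm (l k)) * ennreal (t ^ nat \<bar>j - n k\<bar>) \<partial>count_space UNIV)"
      unfolding suminf_int_decode[of S] unfolding S_def by (subst nn_integral_suminf) auto
    also have "\<dots> \<le> (\<Sum>k. ennreal (norm (l k)) * ennreal (2 / (1 - t)))"
      using t by (intro suminf_le) (auto simp: nn_integral_cmult intro!: mult_left_mono nn_integral_geometric_int)
    also have "\<dots> = ennreal B"
    proof -
      have "(\<Sum>k. ennreal (norm (l k)) * ennreal (2 / (1 - t))) = ennreal (\<Sum>k. norm (l k)) * ennreal (2 / (1 - t))"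
        by (simp only: ennreal_suminf_multc suminf_ennreal2[OF norm_ge_zero l])
      also have "\<dots> = ennreal B"
        unfolding B_def using l t by (intro ennreal_mult[symmetric] suminf_nonneg) auto
      finally show ?thesis .
    qed
    finally show ?thesis .
  qed
  have Sfin: "S j < top" for j
    using ennreal_suminf_lessD[OF le_less_trans[OF SB ennreal_less_top], of "int_encode j"] by simp
  define L where "L j = D * enn2real (S j)" for j
  have S: "S j = ennreal (enn2real (S j))" for j using Sfin[of j] by simp
  have sm: "summable (\<lambda>k. enn2real (S (int_decode k)))"
  proof (rule summable_suminf_not_top)
    show "(\<Sum>k. ennreal (enn2real (S (int_decode k)))) \<noteq> top"
      unfolding S[symmetric] using SB by (auto simp: top_unique)
  qed simp
  have "ennreal (\<Sum>k. enn2real (S (int_decode k))) = (\<Sum>k. S (int_decode k))"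
    unfolding suminf_ennreal2[OF enn2real_nonneg sm, symmetric] S[symmetric] by (rule refl)
  then have le: "(\<Sum>k. enn2real (S (int_decode k))) \<le> B" using SB by (metis B0 ennreal_le_iff)
  show ?thesis
  proof (rule that[of L])
    show "0 \<le> L j" for j using D by (simp add: L_def)
    show "summable (\<lambda>k. L (int_decode k))" unfolding L_def by (intro summable_mult sm)
    show "(\<Sum>k. L (int_decode k)) \<le> D * (2 / (1 - t)) * (\<Sum>k. norm (l k))"
      unfolding L_def suminf_mult[OF sm] using mult_left_mono[OF le D] by (simp add: B_def mult_ac)
    fix x :: "'p padic" and j assume x: "padic_abs x = real CARD('p) powi j"
    define X where "X = padic_abs x"
    have X: "X = q powi j" by (simp add: X_def x q_def)
    have X0: "0 < X" using q by (simp add: X)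
    define E where "E = X powr (- (1 / r + \<alpha>))"
    let ?h = "\<lambda>k y. ennreal (norm (l k)) * ennreal (indicator (- {0}) y * (norm (a k y) / (X + padic_abs y)))"
    \<comment> \<open>The decomposition holds for almost every \<open>y\<close>, and the possibly
      divergent series of norms is harmless in \<open>ennreal\<close>.\<close>
    have "AE y in M. ennreal (norm (indicator (- {0}) y *\<^sub>R hilbert_integrand f x y)) \<le> (\<Sum>k. ?h k y)"
      using ae
    proof eventually_elim
      case (elim y)
      show ?case
      proof (cases "y = 0")
        case False
        have p: "0 < X + padic_abs y" using X0 padic_abs_nonneg[of y] by linarith
        have "(\<lambda>k. l k * a k y / of_real (X + padic_abs y)) sums (f y / of_real (X + padic_abs y))"
          using elim False by (intro sums_divide) auto
        then have "ennreal (norm (f y / of_real (X + padic_abs y)))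
           \<le> (\<Sum>k. ennreal (norm (l k * a k y / of_real (X + padic_abs y))))"
          by (rule ennreal_norm_sums_le)
        moreover have "ennreal (norm (l k * a k y / of_real (X + padic_abs y))) = ?h k y" for k
          using False p by (simp add: norm_mult norm_divide del: of_real_add flip: ennreal_mult)
        ultimately show ?thesis
          using False by (simp add: hilbert_integrand_def X_def)
      qed simp
    qed
    then have "(\<integral>\<^sup>+y. ennreal (norm (indicator (- {0}) y *\<^sub>R hilbert_integrand f x y)) \<partial>M)
        \<le> (\<integral>\<^sup>+y. (\<Sum>k. ?h k y) \<partial>M)"
      by (rule nn_integral_mono_AE)
    also have "\<dots> = (\<Sum>k. ennreal (norm (l k)) * (\<integral>\<^sup>+y. ennreal (indicator (- {0}) y * (norm (a k y) / (X + padic_abs y))) \<partial>M))"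
    proof -
      have "(\<lambda>y. ennreal (indicator (- {0}) y * (norm (a k y) / (X + padic_abs y)))) \<in> borel_measurable M" for k
      proof -
        have [measurable]: "(\<lambda>y. indicator (- {0}) y *\<^sub>R a k y) \<in> borel_measurable M"
          using ak[of k] by (simp add: in_Lr_def set_borel_measurable_def)
        have eq: "(\<lambda>y. ennreal (indicator (- {0}) y * (norm (a k y) / (X + padic_abs y))))
          = (\<lambda>y. ennreal (norm (indicator (- {0}) y *\<^sub>R a k y) / (X + padic_abs y)))"
          by (auto simp: indicator_def)
        show ?thesis unfolding eq by measurable
      qed
      then show ?thesis by (subst nn_integral_suminf) (auto simp: nn_integral_cmult)
    qed
    also have "\<dots> \<le> (\<Sum>k. ennreal (norm (l k)) * ennreal (D * E * t ^ nat \<bar>j - n k\<bar>))"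
      unfolding X D_def E_def t_def q_def
      by (intro suminf_le mult_left_mono central_block_hilbert_le ak n r \<delta>) auto
    also have "\<dots> = (\<Sum>k. ennreal (D * E) * (ennreal (norm (l k)) * ennreal (t ^ nat \<bar>j - n k\<bar>)))"
      using D t by (subst ennreal_mult) (auto simp: E_def mult_ac)
    also have "\<dots> = ennreal (D * E) * S j" unfolding S_def by (rule ennreal_suminf_cmult)
    also have "\<dots> = ennreal (L j * E)"
      using D by (subst S) (simp add: L_def E_def mult_ac flip: ennreal_mult)
    finally show "(\<integral>\<^sup>+y. ennreal (norm (indicator (- {0}) y *\<^sub>R hilbert_integrand f x y)) \<partial>M)
         \<le> ennreal (L j * padic_abs x powr (- (1 / r + \<alpha>)))" by (simp add: E_def X_def)
  qed
qed

text \<open>The new coefficients are the \<open>L j\<close> reindexed by the naturals. Since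
  \<open>C\<close> does not depend on \<open>l\<close> and \<open>a\<close>, an infimum over
  decompositions can be taken afterwards.\<close>

lemma block_decomp_hilbert:
  fixes r \<alpha> \<delta> :: real and f :: "'p padic \<Rightarrow> complex"
  defines "C \<equiv> (1 + 1 / (1 - real CARD('p) powr (- (1 / r)))) * (2 / (1 - real CARD('p) powr (- \<delta>)))"
  assumes f: "in_Lr_loc M r f" and dec: "block_decomp M r \<alpha> f l a"
    and r: "1 < r" and \<delta>: "0 < \<delta>" "\<delta> \<le> \<alpha>" "\<delta> \<le> 1 - 1 / r - \<alpha>"
  shows "x \<noteq> 0 \<Longrightarrow> set_integrable M (- {0}) (hilbert_integrand f x)"
    and "\<exists>l' a'. block_decomp M r \<alpha> (hilbert_op M f) l' a' \<and> (\<Sum>k. norm (l' k)) \<le> C * (\<Sum>k. norm (l k))"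
proof -
  obtain L where L: "\<And>j. 0 \<le> L j" "summable (\<lambda>k. L (int_decode k))"
    "(\<Sum>k. L (int_decode k)) \<le> C * (\<Sum>k. norm (l k))"
    "\<And>x j. padic_abs x = real CARD('p) powi j \<Longrightarrow>
       (\<integral>\<^sup>+y. ennreal (norm (indicator (- {0}) y *\<^sub>R hilbert_integrand f x y)) \<partial>M)
         \<le> ennreal (L j * padic_abs x powr (- (1 / r + \<alpha>)))"
    unfolding C_def by (rule block_decomp_nn_integral_hilbert_le[OF dec r \<delta>]) blast
  have [measurable]: "(\<lambda>y. indicator (- {0}) y *\<^sub>R f y) \<in> borel_measurable M"
    using f by (simp add: in_Lr_loc_def set_borel_measurable_def)
  have m: "(\<lambda>y. indicator (- {0}) y *\<^sub>R hilbert_integrand f x y) \<in> borel_measurable M" for x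
  proof -
    have eq: "(\<lambda>y. indicator (- {0}) y *\<^sub>R hilbert_integrand f x y)
       = (\<lambda>y. (indicator (- {0}) y *\<^sub>R f y) / of_real (padic_abs x + padic_abs y))"
      by (simp add: hilbert_integrand_def scaleR_conv_of_real)
    show ?thesis unfolding eq by measurable
  qed
  have int: "integrable M (\<lambda>y. indicator (- {0}) y *\<^sub>R hilbert_integrand f x y)"
    if "padic_abs x = real CARD('p) powi j" for x j
    using L(4)[OF that] by (intro integrableI_bounded m) (auto intro: le_less_trans)
  show "set_integrable M (- {0}) (hilbert_integrand f x)" if "x \<noteq> 0"
    using padic_abs_powi[OF that] int unfolding set_integrable_def by metis
  have bound: "norm (hilbert_op M f x) \<le> L j * padic_abs x powr (- (1 / r + \<alpha>))"
    if x: "padic_abs x = real CARD('p) powi j" for x j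
  proof -
    have "ennreal (norm (hilbert_op M f x)) \<le> (\<integral>\<^sup>+y. ennreal (norm (indicator (- {0}) y *\<^sub>R hilbert_integrand f x y)) \<partial>M)"
      unfolding hilbert_op_def set_lebesgue_integral_def by (rule integral_norm_bound_ennreal[OF int[OF x]])
    also note L(4)[OF x]
    finally show ?thesis using L(1)[of j] by simp
  qed
  have "in_Lr_loc M r (hilbert_op M f)"
    using r by (intro in_Lr_loc_continuous_on continuous_on_hilbert_op) auto
  then have "set_borel_measurable M (- {0}) (hilbert_op M f)" by (simp add: in_Lr_loc_def)
  from block_decomp_spheres[OF this _ bound L(1,2)] r L(1,3)
  show "\<exists>l' a'. block_decomp M r \<alpha> (hilbert_op M f) l' a' \<and> (\<Sum>k. norm (l' k)) \<le> C * (\<Sum>k. norm (l k))"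
    by fastforce
qed

end

section \<open>Passage to the infimum over decompositions\<close>

theorem theorem3p3:
  fixes dx :: "'p::prime_card padic measure" and r \<alpha> :: real
  assumes "is_haar dx"
    and "1 < r" and "0 < \<alpha>"
    and "0 < 1 / r + \<alpha>" and "1 / r + \<alpha> < 1"
  shows "\<exists>C>0. \<forall>f \<in> block_space dx r \<alpha>.
           (\<forall>x. x \<noteq> 0 \<longrightarrow> set_integrable dx (- {0}) (hilbert_integrand f x))
         \<and> hilbert_op dx f \<in> block_space dx r \<alpha>
         \<and> block_norm dx r \<alpha> (hilbert_op dx f) \<le> C * block_norm dx r \<alpha> f"
proof -
  \<comment> \<open>The worse of the two gain exponents; \<open>\<alpha> > 0\<close> makes one
    positive, \<open>1 / r + \<alpha> < 1\<close> the other.\<close>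
  define \<delta> where "\<delta> = min \<alpha> (1 - 1 / r - \<alpha>)"
  have \<delta>: "0 < \<delta>" "\<delta> \<le> \<alpha>" "\<delta> \<le> 1 - 1 / r - \<alpha>" using assms by (auto simp: \<delta>_def)
  define C where "C = (1 + 1 / (1 - real CARD('p) powr (- (1 / r)))) * (2 / (1 - real CARD('p) powr (- \<delta>)))"
  note hilbert = block_decomp_hilbert[OF assms(1) _ _ assms(2) \<delta>, folded C_def]
  have C: "0 < C" unfolding C_def using P.p_gt_1[where 'p='p] assms(2) \<delta>(1)
    by (intro mult_pos_pos add_pos_pos divide_pos_pos) (auto simp: powr_less_one)
  show ?thesis
  proof (intro exI[of _ C] conjI ballI C)
    fix f assume "f \<in> block_space dx r \<alpha>"
    then obtain l a where f: "in_Lr_loc dx r f" and dec: "block_decomp dx r \<alpha> f l a"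
      by (auto simp: block_space_def)
    show "\<forall>x. x \<noteq> 0 \<longrightarrow> set_integrable dx (- {0}) (hilbert_integrand f x)"
      using hilbert(1)[OF f dec] by blast
    have "in_Lr_loc dx r (hilbert_op dx f)"
      using assms(2) by (intro in_Lr_loc_continuous_on[OF assms(1)] continuous_on_hilbert_op[OF assms(1)]) auto
    then show "hilbert_op dx f \<in> block_space dx r \<alpha>"
      using hilbert(2)[OF f dec] by (auto simp: block_space_def)
    \<comment> \<open>Dividing by \<open>C\<close> makes the left side a candidate lower bound for
      the decomposition sums of \<open>f\<close>, each of which is tested against its own
      decomposition of the transform.\<close>
    have "block_norm dx r \<alpha> (hilbert_op dx f) / C \<le> block_norm dx r \<alpha> f"
      unfolding block_norm_def[of _ _ _ f]
    proof (rule cInf_greatest)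
      show "{\<Sum>k. norm (l k) |l a. block_decomp dx r \<alpha> f l a} \<noteq> {}" using dec by blast
      fix s assume "s \<in> {\<Sum>k. norm (l k) |l a. block_decomp dx r \<alpha> f l a}"
      then obtain l a where s: "s = (\<Sum>k. norm (l k))" and dec: "block_decomp dx r \<alpha> f l a" by blast
      obtain l' a' where d': "block_decomp dx r \<alpha> (hilbert_op dx f) l' a'"
        and le: "(\<Sum>k. norm (l' k)) \<le> C * s"
        using hilbert(2)[OF f dec] s by blast
      have "block_norm dx r \<alpha> (hilbert_op dx f) \<le> (\<Sum>k. norm (l' k))"
        unfolding block_norm_def
      proof (rule cInf_lower)
        \<comment> \<open>A real infimum lies below the members of its set only once the set is
          bounded below, here by 0.\<close>
        show "bdd_below {\<Sum>k. norm (l k) |l a. block_decomp dx r \<alpha> (hilbert_op dx f) l a}"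
          by (intro bdd_belowI[of _ 0]) (auto simp: block_decomp_def suminf_nonneg)
      qed (use d' in blast)
      with le show "block_norm dx r \<alpha> (hilbert_op dx f) / C \<le> s"
        using C by (simp add: pos_divide_le_eq mult.commute)
    qed
    then show "block_norm dx r \<alpha> (hilbert_op dx f) \<le> C * block_norm dx r \<alpha> f"
      using C by (simp add: pos_divide_le_eq mult.commute)
  qed
qed

end
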